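(* Let $\lambda$ be a nonzero finite Borel measure on $\mathbb R_+^d$ with $\int_{\mathbb R_+^d}\|a\|_1\,\lambda(da)<\infty$, and use the linear scores $s_a(x)=a\cdot x$, $a\in\Theta=\mathbb R_+^d$. For every $\gamma\in[0,1]$, $P\preceq_{s,\lambda,\gamma}^{\rm CSD}Q$ if and only if $\int_D u\,dP\le\int_D u\,dQ$ for every differentiable $u:\mathbb R^d\to\mathbb R$ satisfying $\nabla u(x)\in\mathcal B_{\lambda,\gamma}$ for every $x\in\mathbb R^d$, where $$\mathcal B_{\lambda,\gamma}:=\left\{\int_{\mathbb R_+^d}r(a)\,a\,\lambda(da):\ r\text{ measurable and }\gamma\le r(a)\le1\right\}.$$
   Context: Let $D\subseteq\mathbb R^d$ be a nonempty Borel set; $P,Q$ are Borel probability measures supported on $D$ (i.e. $P(D)=Q(D)=1$) with finite first moments. $\mathcal C(P,Q)$ is the set of couplings of $P$ and $Q$ (first marginal $P$, second marginal $Q$), and $t_+:=\max\{t,0\}$. Compensated stochastic dominance (CSD) for a measurable family of scores $(s_\theta)_{\theta\in\Theta}$ on $\mathbb R^d$ with finite weighting measure $\lambda$ on $\Theta$ and $\gamma\in[0,1]$: $P\preceq_{s,\lambda,\gamma}^{\rm CSD}Q$ means that there exists $\kappa\in\mathcal C(P,Q)$ with $$\int_{D\times D}\int_\Theta(s_\theta(x)-s_\theta(y))_+\,\lambda(d\theta)\,\kappa(dx,dy)\le\gamma\int_{D\times D}\int_\Theta(s_\theta(y)-s_\theta(x))_+\,\lambda(d\theta)\,\kappa(dx,dy).$$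 *)

theory Defs
  imports "HOL-Probability.Probability"
begin

definition couplings :: "'a measure \<Rightarrow> 'b measure \<Rightarrow> ('a \<times> 'b) measure set" where
  "couplings P Q = {\<kappa>. prob_space \<kappa> \<and> sets \<kappa> = sets (P \<Otimes>\<^sub>M Q)
     \<and> distr \<kappa> P fst = P \<and> distr \<kappa> Q snd = Q}"

text \<open>
  The integrands are nonnegative and the scores are arbitrary, so the integrals are taken in the
  extended nonnegative reals, with the convention that zero times infinity is zero.
\<close>

definition CSD ::
  "(real ^ 'n) set \<Rightarrow> ('t \<Rightarrow> real ^ 'n \<Rightarrow> real) \<Rightarrow> 't measure \<Rightarrow> real
    \<Rightarrow> (real ^ 'n) measure \<Rightarrow> (real ^ 'n) measure \<Rightarrow> bool" where
  "CSD D s lam \<gamma> P Q \<longleftrightarrow> (\<exists>\<kappa> \<in> couplings P Q.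
     (\<integral>\<^sup>+(x, y)\<in>D \<times> D. (\<integral>\<^sup>+\<theta>. ennreal (max (s \<theta> x - s \<theta> y) 0) \<partial>lam) \<partial>\<kappa>)
     \<le> ennreal \<gamma> *
       (\<integral>\<^sup>+(x, y)\<in>D \<times> D. (\<integral>\<^sup>+\<theta>. ennreal (max (s \<theta> y - s \<theta> x) 0) \<partial>lam) \<partial>\<kappa>))"

definition nonneg_orthant :: "(real ^ 'n) set" where
  "nonneg_orthant = {a. \<forall>i. 0 \<le> a $ i}"

definition gradient_set :: "(real ^ 'n) measure \<Rightarrow> real \<Rightarrow> (real ^ 'n) set" where
  "gradient_set lam \<gamma> = {(\<integral>a. r a *\<^sub>R a \<partial>lam) | r.
     r \<in> borel_measurable lam \<and> (\<forall>a \<in> space lam. \<gamma> \<le> r a \<and> r a \<le> 1)}"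

end

theory Submission
  imports Defs
begin

text \<open>
  Put \<open>h z = \<integral> max (a \<bullet> z) (\<gamma> * (a \<bullet> z)) d\<lambda>(a)\<close>, the support function of the gradient set. It is
  sublinear, CSD asks for a coupling with \<open>\<integral> h (x - y) d\<kappa> \<le> 0\<close>, and a differentiable \<open>u\<close> with
  gradients in the gradient set satisfies \<open>u x - u y \<le> h (x - y)\<close>; this gives the forward implication.

  Conversely, mollification extends the inequality \<open>\<integral> v dP \<le> \<integral> v dQ\<close> to all \<open>v\<close> with
  \<open>v x - v y \<le> h (x - y)\<close>. Then the functional
  \<open>p f = inf {\<integral> \<phi> dP + \<integral> \<psi> dQ | f (x, y) \<le> \<phi> x + \<psi> y + t * h (x - y), t \<ge> 0}\<close>
  is finite and sublinear on functions of linear growth. A linear functional below \<open>p\<close> (Hahn-Banach)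
  is positive, has marginals \<open>P\<close> and \<open>Q\<close> and is nonpositive on the cost, so it induces a finitely
  additive coupling. The marginals make it countably additive on rectangles, which yields \<open>\<kappa>\<close>.
\<close>

section \<open>Linear functionals below a sublinear one\<close>

text \<open>Zorn's lemma yields a pointwise minimal sublinear functional below \<open>p\<close>, and
  minimality forces it to be linear. The space is a set of functions closed under sums and
  multiples, so the result applies directly to functions of linear growth.\<close>

lemma hahn_banach_function_space:
  fixes V :: "('a \<Rightarrow> real) set" and p :: "('a \<Rightarrow> real) \<Rightarrow> real"
  assumes nonempty: "V \<noteq> {}"
    and add: "\<And>f g. f \<in> V \<Longrightarrow> g \<in> V \<Longrightarrow> (\<lambda>x. f x + g x) \<in> V"
    and scale: "\<And>f c. f \<in> V \<Longrightarrow> (\<lambda>x. c * f x) \<in> V"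
    and p_add: "\<And>f g. f \<in> V \<Longrightarrow> g \<in> V \<Longrightarrow> p (\<lambda>x. f x + g x) \<le> p f + p g"
    and p_scale: "\<And>f c. f \<in> V \<Longrightarrow> 0 < c \<Longrightarrow> p (\<lambda>x. c * f x) \<le> c * p f"
  obtains L where "\<And>f g. f \<in> V \<Longrightarrow> g \<in> V \<Longrightarrow> L (\<lambda>x. f x + g x) = L f + L g"
    and "\<And>f c. f \<in> V \<Longrightarrow> L (\<lambda>x. c * f x) = c * L f"
    and "\<And>f. f \<in> V \<Longrightarrow> L f \<le> p f"
proof -
  \<comment> \<open>Fixing the value 0 outside \<open>V\<close> keeps pointwise infima bounded below
    everywhere and lets functionals be compared on all functions.\<close>
  define sub where "sub q \<longleftrightarrow> (\<forall>f\<in>V. \<forall>g\<in>V. q (\<lambda>x. f x + g x) \<le> q f + q g) \<and>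
      (\<forall>f\<in>V. \<forall>c>0. q (\<lambda>x. c * f x) \<le> c * q f) \<and> (\<forall>f\<in>V. q f \<le> p f) \<and> (\<forall>f. f \<notin> V \<longrightarrow> q f = 0)"
    for q :: "('a \<Rightarrow> real) \<Rightarrow> real"
  have subD: "f \<in> V \<Longrightarrow> g \<in> V \<Longrightarrow> q (\<lambda>x. f x + g x) \<le> q f + q g"
    "f \<in> V \<Longrightarrow> 0 < c \<Longrightarrow> q (\<lambda>x. c * f x) \<le> c * q f" "f \<in> V \<Longrightarrow> q f \<le> p f"
    "f \<notin> V \<Longrightarrow> q f = 0" if "sub q" for q f g c
    using that unfolding sub_def by blast+
  have zero: "(\<lambda>x. 0) \<in> V"
    using nonempty scale[of _ 0] by auto
  have sub_zero: "q (\<lambda>x. 0) = 0" if "sub q" for q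
    using subD(2)[OF that zero, of 2] subD(2)[OF that zero, of "1/2"] by simp
  have uminus: "(\<lambda>x. - f x) \<in> V" if "f \<in> V" for f
    using scale[OF that, of "-1"] by simp
  have sub_uminus: "0 \<le> q f + q (\<lambda>x. - f x)" if "sub q" "f \<in> V" for q f
    using subD(1)[OF that(1,2) uminus[OF that(2)]] sub_zero[OF that(1)] by simp
  have sub_lower: "- p (\<lambda>x. - f x) \<le> q f" if "sub q" "f \<in> V" for q f
    using sub_uminus[OF that] subD(3)[OF that(1) uminus[OF that(2)]] by linarith
  have sub_scale: "q (\<lambda>x. c * f x) = c * q f" if "sub q" "f \<in> V" "0 \<le> c" for q f c
  proof (cases "c = 0")
    case True
    then show ?thesis using sub_zero[OF that(1)] by simp
  next
    case False
    with that have c: "0 < c" by simp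
    have "q f \<le> (1 / c) * q (\<lambda>x. c * f x)"
      using subD(2)[OF that(1) scale[OF that(2), of c], of "1 / c"] c by simp
    then show ?thesis
      using subD(2)[OF that(1,2) c] c by (simp add: field_simps)
  qed
  let ?R = "relation_of (\<lambda>q r :: ('a \<Rightarrow> real) \<Rightarrow> real. r \<le> q) {q. sub q}"
  \<comment> \<open>The order is reversed: a chain is bounded by its pointwise infimum, which exists
    on \<open>V\<close> because of \<open>sub_lower\<close>, and a maximal element is a minimal
    functional.\<close>
  have "\<exists>q\<in>{q. sub q}. \<forall>r\<in>{q. sub q}. r \<le> q \<longrightarrow> r = q"
  proof (rule predicate_Zorn)
    show "partial_order_on {q. sub q} ?R"
      by (rule partial_order_on_relation_ofI) auto
    fix C assume C: "C \<in> Chains ?R"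
    have C_sub: "sub q" if "q \<in> C" for q
      using C that unfolding Chains_def relation_of_def by auto
    have C_total: "q \<le> r \<or> r \<le> q" if "q \<in> C" "r \<in> C" for q r
      using C that unfolding Chains_def relation_of_def by auto
    show "\<exists>u\<in>{q. sub q}. \<forall>a\<in>C. u \<le> a"
    proof (cases "C = {}")
      case True
      have "sub (\<lambda>f. if f \<in> V then p f else 0)"
        unfolding sub_def using add scale p_add p_scale by simp
      with True show ?thesis by auto
    next
      case False
      define u where "u f = (INF q\<in>C. q f)" for f
      have bdd: "bdd_below ((\<lambda>q. q f) ` C)" for f
      proof (cases "f \<in> V")
        case True
        then show ?thesis using sub_lower C_sub by (intro bdd_belowI2) blast
      next
        case False
        then have "0 \<le> q f" if "q \<in> C" for q
          using subD(4)[OF C_sub[OF that], of f] by simp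
        then show ?thesis by (intro bdd_belowI2)
      qed
      have u_le: "u f \<le> q f" if "q \<in> C" for q f
        unfolding u_def using bdd that by (rule cINF_lower)
      have le_u: "b \<le> u f" if "\<And>q. q \<in> C \<Longrightarrow> b \<le> q f" for b f
        unfolding u_def using False that by (rule cINF_greatest)
      have "sub u"
        unfolding sub_def
      proof (intro conjI ballI allI impI)
        fix f g assume fg: "f \<in> V" "g \<in> V"
        \<comment> \<open>Two members of a chain are comparable, so the smaller one serves as
          \<open>s\<close> for both.\<close>
        have *: "u (\<lambda>x. f x + g x) \<le> q f + r g" if qr: "q \<in> C" "r \<in> C" for q r
        proof -
          obtain s where s: "s \<in> C" "s \<le> q" "s \<le> r"
            using C_total[OF qr] qr by auto
          have "u (\<lambda>x. f x + g x) \<le> s (\<lambda>x. f x + g x)" using s(1) by (rule u_le)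
          also have "\<dots> \<le> s f + s g" using subD(1) C_sub s(1) fg by blast
          also have "\<dots> \<le> q f + r g" using s by (simp add: le_funD add_mono)
          finally show ?thesis .
        qed
        have "u (\<lambda>x. f x + g x) - u g \<le> q f" if "q \<in> C" for q
          using le_u[of "u (\<lambda>x. f x + g x) - q f" g] *[OF that] by (simp add: diff_le_eq add.commute)
        then show "u (\<lambda>x. f x + g x) \<le> u f + u g"
          using le_u[of "u (\<lambda>x. f x + g x) - u g" f] by (simp add: diff_le_eq)
      next
        fix f and c :: real assume f: "f \<in> V" and c: "0 < c"
        have "u (\<lambda>x. c * f x) / c \<le> q f" if "q \<in> C" for q
          using u_le[OF that, of "\<lambda>x. c * f x"] subD(2)[OF C_sub[OF that] f c] c
          by (simp add: field_simps)
        then have "u (\<lambda>x. c * f x) / c \<le> u f" by (rule le_u)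
        then show "u (\<lambda>x. c * f x) \<le> c * u f"
          using c by (simp add: field_simps)
      next
        fix f assume "f \<in> V"
        then show "u f \<le> p f"
          using False u_le[of _ f] C_sub subD(3) by (meson all_not_in_conv order_trans)
      next
        fix f assume "f \<notin> V"
        then have "(\<lambda>q. q f) ` C = {0}"
          using False C_sub subD(4) by fastforce
        then show "u f = 0"
          unfolding u_def by simp
      qed
      then show ?thesis
        using u_le by (intro bexI[of _ u]) (auto simp: le_fun_def)
    qed
  qed
  then obtain q where q: "sub q" and q_min: "\<And>r. sub r \<Longrightarrow> r \<le> q \<Longrightarrow> r = q"
    by auto
  have super: "q f + q g \<le> q (\<lambda>x. f x + g x)" if f: "f \<in> V" and g: "g \<in> V" for f g
  proof -
    \<comment> \<open>The functional \<open>r\<close> is again sublinear and lies below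
      \<open>q\<close> by the choice \<open>t = 0\<close>, so \<open>r = q\<close> by minimality.
      The choice \<open>t = 1\<close> then gives superadditivity in the direction
      \<open>g\<close>.\<close>
    define F where "F f t = q (\<lambda>x. f x + t * g x) - t * q g" for f t
    define r where "r f = (if f \<in> V then INF t\<in>{0..}. F f t else 0)" for f
    have in_V: "(\<lambda>x. f x + t * g x) \<in> V" if "f \<in> V" for f t
      using add[OF that scale[OF g]] .
    have bdd: "bdd_below (F f ` {0..})" if "f \<in> V" for f
    proof (intro bdd_belowI2)
      fix t :: real assume "t \<in> {0..}"
      then have "t * q g = q (\<lambda>x. t * g x)" using sub_scale[OF q g] by simp
      also have "\<dots> \<le> q (\<lambda>x. f x + t * g x) + q (\<lambda>x. - f x)"
        using subD(1)[OF q in_V[OF that, of t] uminus[OF that]] by simp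
      finally show "- q (\<lambda>x. - f x) \<le> F f t" unfolding F_def by linarith
    qed
    have r_le: "r f \<le> F f t" if "f \<in> V" "0 \<le> t" for f t
      unfolding r_def using that bdd[OF that(1)] by (auto intro!: cINF_lower)
    have le_r: "b \<le> r f" if "f \<in> V" "\<And>t. 0 \<le> t \<Longrightarrow> b \<le> F f t" for b f
      unfolding r_def using that by (auto intro!: cINF_greatest)
    have "sub r"
      unfolding sub_def
    proof (intro conjI ballI allI impI)
      fix f1 f2 assume f12: "f1 \<in> V" "f2 \<in> V"
      have *: "r (\<lambda>x. f1 x + f2 x) \<le> F f1 s + F f2 t" if "0 \<le> s" "0 \<le> t" for s t
      proof -
        have "r (\<lambda>x. f1 x + f2 x) \<le> F (\<lambda>x. f1 x + f2 x) (s + t)"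
          using that f12 add by (intro r_le) auto
        also have "\<dots> \<le> F f1 s + F f2 t"
          using subD(1)[OF q in_V[OF f12(1), of s] in_V[OF f12(2), of t]]
          unfolding F_def by (simp add: algebra_simps)
        finally show ?thesis .
      qed
      have "r (\<lambda>x. f1 x + f2 x) - r f2 \<le> F f1 s" if "0 \<le> s" for s
        using le_r[OF f12(2), of "r (\<lambda>x. f1 x + f2 x) - F f1 s"] *[OF that]
        by (simp add: diff_le_eq add.commute)
      then show "r (\<lambda>x. f1 x + f2 x) \<le> r f1 + r f2"
        using le_r[OF f12(1), of "r (\<lambda>x. f1 x + f2 x) - r f2"] by (simp add: diff_le_eq)
    next
      fix f1 and c :: real assume f1: "f1 \<in> V" and c: "0 < c"
      have "r (\<lambda>x. c * f1 x) / c \<le> F f1 t" if "0 \<le> t" for t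
      proof -
        have "r (\<lambda>x. c * f1 x) \<le> F (\<lambda>x. c * f1 x) (c * t)"
          using that c f1 scale by (intro r_le) auto
        also have "\<dots> \<le> c * F f1 t"
          using subD(2)[OF q in_V[OF f1, of t] c] unfolding F_def by (simp add: algebra_simps)
        finally show ?thesis using c by (simp add: field_simps)
      qed
      then have "r (\<lambda>x. c * f1 x) / c \<le> r f1" by (rule le_r[OF f1])
      then show "r (\<lambda>x. c * f1 x) \<le> c * r f1" using c by (simp add: field_simps)
    next
      fix f1 assume f1: "f1 \<in> V"
      show "r f1 \<le> p f1"
        using r_le[OF f1, of 0] subD(3)[OF q f1] unfolding F_def by simp
    qed (simp add: r_def)
    moreover have "r \<le> q"
    proof (rule le_funI)
      fix f1 show "r f1 \<le> q f1"
        using r_le[of f1 0] subD(4)[OF q, of f1] unfolding F_def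
        by (cases "f1 \<in> V") (auto simp: r_def)
    qed
    ultimately have "r = q" by (rule q_min)
    then show ?thesis
      using r_le[OF f, of 1] unfolding F_def by simp
  qed
  have q_add: "q (\<lambda>x. f x + g x) = q f + q g" if "f \<in> V" "g \<in> V" for f g
    using super[OF that] subD(1)[OF q that] by linarith
  have q_uminus: "q (\<lambda>x. - f x) = - q f" if "f \<in> V" for f
    using q_add[OF that uminus[OF that]] sub_zero[OF q] by simp
  have q_scale: "q (\<lambda>x. c * f x) = c * q f" if "f \<in> V" for f c
  proof (cases "0 \<le> c")
    case True
    then show ?thesis using sub_scale[OF q that] by simp
  next
    case False
    then show ?thesis
      using sub_scale[OF q uminus[OF that], of "- c"] q_uminus[OF that] by simp
  qed
  show ?thesis
    using that[of q] q_add q_scale subD(3)[OF q] by blast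
qed

section \<open>Couplings from finitely additive contents\<close>

text \<open>Inner regularity of finite Borel measures on Polish spaces, phrased through the mass
  left uncovered, which is the form used for rectangles.\<close>

lemma compact_subset_small_diff:
  fixes P :: "'a::{second_countable_topology, complete_space} measure"
  assumes "finite_measure P" and sets: "sets P = sets borel" and A: "A \<in> sets borel" and e: "0 < (e::real)"
  obtains K where "compact K" "K \<subseteq> A" "measure P (A - K) < e"
proof -
  interpret finite_measure P by fact
  have "\<exists>K. compact K \<and> K \<subseteq> A \<and> measure P A - e < measure P K"
  proof (rule ccontr)
    assume "\<nexists>K. compact K \<and> K \<subseteq> A \<and> measure P A - e < measure P K"
    then have le: "measure P K \<le> measure P A - e" if "compact K" "K \<subseteq> A" for K
      using that by (meson not_less)
    have "emeasure P A = (SUP K\<in>{K. K \<subseteq> A \<and> compact K}. emeasure P K)"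
      using A sets by (intro inner_regular) simp_all
    also have "\<dots> \<le> ennreal (measure P A - e)"
      using le by (intro SUP_least) (auto simp: emeasure_eq_measure ennreal_leI)
    \<comment> \<open>The empty compact set shows that \<open>measure P A - e\<close> is
      nonnegative, so \<open>ennreal\<close> does not truncate it.\<close>
    finally have "measure P A \<le> measure P A - e"
      using le[of "{}"] by (simp add: emeasure_eq_measure)
    with e show False by simp
  qed
  then obtain K where K: "compact K" "K \<subseteq> A" "measure P A - e < measure P K"
    by blast
  have "measure P (A - K) = measure P A - measure P K"
    using A K(2) borel_compact[OF K(1)] sets by (intro finite_measure_Diff) simp_all
  then have "measure P (A - K) < e" using K(3) by linarith
  with K(1,2) show ?thesis by (rule that)
qed

text \<open>
  Countable additivity is inherited from the marginals: rectangles are approximated from inside by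
  compact rectangles, uniformly over all additive contents with the given marginals.
\<close>

lemma coupling_of_additive_content:
  fixes P :: "'a::{second_countable_topology, complete_space} measure"
    and Q :: "'b::{second_countable_topology, complete_space} measure"
    and m :: "('a \<times> 'b) set \<Rightarrow> real"
  assumes P: "prob_space P" "sets P = sets borel" and Q: "prob_space Q" "sets Q = sets borel"
    and nonneg: "\<And>S. 0 \<le> m S"
    and additive: "\<And>S T. S \<inter> T = {} \<Longrightarrow> m (S \<union> T) = m S + m T"
    and fst_marginal: "\<And>A. A \<in> sets borel \<Longrightarrow> m (A \<times> UNIV) = measure P A"
    and snd_marginal: "\<And>B. B \<in> sets borel \<Longrightarrow> m (UNIV \<times> B) = measure Q B"
  obtains \<kappa> where "\<kappa> \<in> couplings P Q"
    and "\<And>A B. A \<in> sets borel \<Longrightarrow> B \<in> sets borel \<Longrightarrow> measure \<kappa> (A \<times> B) = m (A \<times> B)"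
proof -
  interpret P: prob_space P by fact
  interpret Q: prob_space Q by fact
  have m_empty: "m {} = 0"
    using additive[of "{}" "{}"] by simp
  have mono: "m S \<le> m T" if "S \<subseteq> T" for S T
    using additive[of S "T - S"] nonneg[of "T - S"] that by (simp add: Un_absorb1)
  have subadd: "m (S \<union> T) \<le> m S + m T" for S T
    using additive[of S "T - S"] mono[of "T - S" T] by simp
  have subadd_finite: "m (\<Union>i\<in>I. S i) \<le> (\<Sum>i\<in>I. m (S i))" if "finite I" for I :: "nat set" and S
    using that
  proof (induction I rule: finite_induct)
    case (insert i I)
    then show ?case using subadd[of "S i" "\<Union>i\<in>I. S i"] by simp
  qed (simp add: m_empty)
  define R where "R = {A \<times> B | A B. A \<in> sets (borel :: 'a measure) \<and> B \<in> sets (borel :: 'b measure)}"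
  have RI: "A \<times> B \<in> R" if "A \<in> sets borel" "B \<in> sets borel" for A B
    using that unfolding R_def by blast
  interpret R: semiring_of_sets UNIV R
  proof
    show "R \<subseteq> Pow UNIV" by simp
    show "{} \<in> R" using RI[of "{}" "{}"] by simp
    fix S T assume "S \<in> R" "T \<in> R"
    then obtain A B A' B' where ST: "S = A \<times> B" "T = A' \<times> B'"
      and [measurable]: "A \<in> sets borel" "B \<in> sets borel" "A' \<in> sets borel" "B' \<in> sets borel"
      unfolding R_def by blast
    have "S \<inter> T = (A \<inter> A') \<times> (B \<inter> B')" using ST by auto
    then show "S \<inter> T \<in> R" using RI[of "A \<inter> A'" "B \<inter> B'"] by simp
    \<comment> \<open>Splitting off the part outside \<open>A'\<close> first and the part outside
      \<open>B'\<close> second leaves two disjoint rectangles.\<close>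
    show "\<exists>C\<subseteq>R. finite C \<and> disjoint C \<and> S - T = \<Union>C"
    proof (intro exI[of _ "{(A - A') \<times> B, (A \<inter> A') \<times> (B - B')}"] conjI)
      show "{(A - A') \<times> B, (A \<inter> A') \<times> (B - B')} \<subseteq> R" by (auto intro!: RI)
      show "disjoint {(A - A') \<times> B, (A \<inter> A') \<times> (B - B')}" by (auto simp: disjoint_def)
    qed (auto simp: ST)
  qed
  let ?G = R.generated_ring
  interpret G: ring_of_sets UNIV ?G by (rule R.generating_ring)
  have rect: "\<exists>K. compact K \<and> K \<subseteq> S \<and> m (S - K) < e" if "S \<in> R" "0 < e" for S e
  proof -
    obtain A B where S: "S = A \<times> B" and AB[measurable]: "A \<in> sets borel" "B \<in> sets borel"
      using \<open>S \<in> R\<close> unfolding R_def by blast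
    obtain K where K: "compact K" "K \<subseteq> A" "measure P (A - K) < e / 2"
      using compact_subset_small_diff[OF P.finite_measure_axioms P(2) AB(1), of "e/2"] \<open>0 < e\<close> by auto
    obtain L where L: "compact L" "L \<subseteq> B" "measure Q (B - L) < e / 2"
      using compact_subset_small_diff[OF Q.finite_measure_axioms Q(2) AB(2), of "e/2"] \<open>0 < e\<close> by auto
    have KL[measurable]: "K \<in> sets borel" "L \<in> sets borel"
      using K L by (auto intro: borel_compact)
    \<comment> \<open>What \<open>K \<times> L\<close> misses lies in two strips whose masses are
      given by the marginals. In this way regularity of \<open>P\<close> and \<open>Q\<close>
      controls the content \<open>m\<close>.\<close>
    have "m (S - K \<times> L) \<le> m ((A - K) \<times> UNIV \<union> UNIV \<times> (B - L))"
      by (rule mono) (auto simp: S)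
    also have "\<dots> \<le> measure P (A - K) + measure Q (B - L)"
      using subadd[of "(A - K) \<times> UNIV" "UNIV \<times> (B - L)"] fst_marginal[of "A - K"]
        snd_marginal[of "B - L"] by simp
    also have "\<dots> < e" using K L by simp
    finally show ?thesis
      using K L S by (intro exI[of _ "K \<times> L"]) (auto intro: compact_Times)
  qed
  have approx: "\<exists>K. compact K \<and> K \<subseteq> S \<and> m (S - K) < e" if "S \<in> ?G" "0 < e" for S e
  proof -
    obtain C where C: "finite C" "C \<subseteq> R" "S = \<Union>C"
      using \<open>S \<in> ?G\<close> unfolding R.generated_ring_def by auto
    \<comment> \<open>Proving the claim for all tolerances at once lets each insertion spend half of
      \<open>e\<close> on the new rectangle and half on the rest.\<close>
    have "\<forall>e>0. \<exists>K. compact K \<and> K \<subseteq> \<Union>C \<and> m (\<Union>C - K) < e"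
      using C(1,2)
    proof (induction C rule: finite_induct)
      case empty
      show ?case by (auto simp: m_empty intro!: exI[of _ "{}"])
    next
      case (insert c C)
      show ?case
      proof (intro allI impI)
        fix e :: real assume "0 < e"
        then have e2: "0 < e / 2" by simp
        obtain K where K: "compact K" "K \<subseteq> \<Union>C" "m (\<Union>C - K) < e / 2"
          using insert.IH[THEN spec, of "e / 2"] insert.prems e2 by (meson insert_subset)
        obtain L where L: "compact L" "L \<subseteq> c" "m (c - L) < e / 2"
          using rect[OF _ e2, of c] insert.prems by (meson insert_subset)
        have "m (\<Union>(insert c C) - (L \<union> K)) \<le> m ((c - L) \<union> (\<Union>C - K))"
          by (rule mono) auto
        also have "\<dots> < e" using subadd[of "c - L" "\<Union>C - K"] K L by linarith
        finally show "\<exists>K. compact K \<and> K \<subseteq> \<Union>(insert c C) \<and> m (\<Union>(insert c C) - K) < e"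
          using K L by (intro exI[of _ "L \<union> K"]) auto
      qed
    qed
    then show ?thesis using C \<open>0 < e\<close> by simp
  qed
  \<comment> \<open>For a finite additive content, Caratheodory's extension asks for continuity at
    the empty set along decreasing sequences.\<close>
  have "\<exists>\<mu>. (\<forall>s\<in>?G. \<mu> s = ennreal (m s)) \<and> measure_space UNIV (sigma_sets UNIV ?G) \<mu>"
  proof (rule G.caratheodory_empty_continuous)
    show "positive ?G (\<lambda>S. ennreal (m S))" by (simp add: positive_def m_empty)
    show "Measure_Space.additive ?G (\<lambda>S. ennreal (m S))"
      by (auto simp: Measure_Space.additive_def additive nonneg)
    show "ennreal (m A) \<noteq> \<infinity>" for A by simp
    fix A :: "nat \<Rightarrow> ('a \<times> 'b) set"
    assume A: "range A \<subseteq> ?G" "decseq A" "(\<Inter>i. A i) = {}"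
    have "(\<lambda>i. m (A i)) \<longlonglongrightarrow> 0"
    proof (rule LIMSEQ_I)
      fix e :: real assume e: "0 < e"
      \<comment> \<open>Compact inner approximations turn the empty intersection into an empty
        finite intersection. The errors \<open>e / 2 ^ (i + 1)\<close> sum to less than
        \<open>e\<close>.\<close>
      have "\<forall>i. \<exists>K. compact K \<and> K \<subseteq> A i \<and> m (A i - K) < e * (1/2) ^ Suc i"
        using A(1) e by (intro allI approx) auto
      then obtain K where K: "\<And>i. compact (K i)" "\<And>i. K i \<subseteq> A i"
        "\<And>i. m (A i - K i) < e * (1/2) ^ Suc i"
        by metis
      have "\<exists>I. finite I \<and> K 0 \<inter> (\<Inter>i\<in>I. K i) = {}"
      proof (rule ccontr)
        assume *: "\<nexists>I. finite I \<and> K 0 \<inter> (\<Inter>i\<in>I. K i) = {}"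
        have "K 0 \<inter> (\<Inter>i\<in>UNIV. K i) \<noteq> {}"
        proof (rule compact_imp_fip_image)
          show "closed (K i)" for i using K(1) by (rule compact_imp_closed)
          show "K 0 \<inter> \<Inter> (K ` I) \<noteq> {}" if "finite I" for I using * that by simp
        qed (rule K(1))
        then obtain x where "x \<in> K i" for i by auto
        then have "x \<in> (\<Inter>i. A i)" using K(2) by auto
        then show False using A(3) by simp
      qed
      then obtain I where I: "finite I" "K 0 \<inter> (\<Inter>i\<in>I. K i) = {}"
        by blast
      obtain N where N: "I \<subseteq> {..N}" using I(1) finite_nat_iff_bounded_le by blast
      have "norm (m (A n) - 0) < e" if "N \<le> n" for n
      proof -
        \<comment> \<open>Since \<open>n\<close> is at least \<open>N\<close>, a point of
          \<open>A n\<close> lies in every \<open>A i\<close> with \<open>i \<le> N\<close>, but it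
          must miss one of the sets \<open>K i\<close>. The extra compact set \<open>K 0\<close>
          also has its index in this range.\<close>
        have "A n \<subseteq> (\<Union>i\<in>{..N}. A i - K i)"
        proof
          fix x assume x: "x \<in> A n"
          have "x \<in> A i" if "i \<le> N" for i
            using x decseqD[OF A(2), of i n] that \<open>N \<le> n\<close> by auto
          moreover obtain i where "i \<le> N" "x \<notin> K i"
            using I(2) N by (metis INT_iff IntI atMost_iff empty_iff le0 subsetD)
          ultimately show "x \<in> (\<Union>i\<in>{..N}. A i - K i)" by blast
        qed
        then have "m (A n) \<le> (\<Sum>i\<le>N. m (A i - K i))"
          using mono[of "A n" "\<Union>i\<in>{..N}. A i - K i"] subadd_finite[of "{..N}" "\<lambda>i. A i - K i"] by simp
        also have "\<dots> \<le> (\<Sum>i\<le>N. e * (1/2) ^ Suc i)"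
          using K(3) by (intro sum_mono) (simp add: less_imp_le)
        also have "\<dots> = e * (1 - (1/2) ^ Suc N)"
          by (induction N) (simp_all add: algebra_simps)
        also have "\<dots> < e" using e by simp
        finally show ?thesis using nonneg[of "A n"] by simp
      qed
      then show "\<exists>no. \<forall>n\<ge>no. norm (m (A n) - 0) < e" by blast
    qed
    then have "(\<lambda>i. ennreal (m (A i))) \<longlonglongrightarrow> ennreal 0" by (rule tendsto_ennrealI)
    then show "(\<lambda>i. ennreal (m (A i))) \<longlonglongrightarrow> 0" by simp
  qed
  then obtain \<mu> where \<mu>: "\<And>S. S \<in> ?G \<Longrightarrow> \<mu> S = ennreal (m S)"
    and ms: "measure_space UNIV (sigma_sets UNIV ?G) \<mu>" by blast
  define \<kappa> where "\<kappa> = measure_of UNIV ?G \<mu>"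
  have space: "space \<kappa> = UNIV" unfolding \<kappa>_def by (simp add: space_measure_of_conv)
  have spP: "space P = UNIV" and spQ: "space Q = UNIV"
    using P(2) Q(2) by (auto dest: sets_eq_imp_space_eq)
  have "sets (P \<Otimes>\<^sub>M Q) = sigma_sets UNIV R"
    unfolding sets_pair_measure R_def by (simp add: P(2) Q(2) spP spQ)
  then have sets: "sets \<kappa> = sets (P \<Otimes>\<^sub>M Q)"
    unfolding \<kappa>_def by (simp add: R.sigma_sets_generated_ring_eq)
  have emeasure: "emeasure \<kappa> (A \<times> B) = ennreal (m (A \<times> B))"
    if "A \<in> sets borel" "B \<in> sets borel" for A B
  proof -
    have G: "A \<times> B \<in> ?G" using RI[OF that] by (rule R.generated_ringI_Basic)
    have "emeasure \<kappa> (A \<times> B) = \<mu> (A \<times> B)"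
      unfolding \<kappa>_def using ms G
      by (intro emeasure_measure_of) (auto simp: measure_space_def)
    then show ?thesis using \<mu>[OF G] by simp
  qed
  have "prob_space \<kappa>"
  proof
    show "emeasure \<kappa> (space \<kappa>) = 1"
      using emeasure[of UNIV UNIV] fst_marginal[of UNIV] P.prob_space spP by (simp add: space)
  qed
  moreover have "distr \<kappa> P fst = P"
  proof (rule measure_eqI)
    fix A assume "A \<in> sets (distr \<kappa> P fst)"
    then have A: "A \<in> sets borel" by (simp add: P(2))
    have "emeasure (distr \<kappa> P fst) A = emeasure \<kappa> (A \<times> UNIV)"
      using A by (subst emeasure_distr) (auto simp: P(2) space sets measurable_cong_sets[OF sets refl] intro!: arg_cong[of _ _ "emeasure \<kappa>"])
    then show "emeasure (distr \<kappa> P fst) A = emeasure P A"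
      using A by (simp add: emeasure fst_marginal P.emeasure_eq_measure)
  qed simp
  moreover have "distr \<kappa> Q snd = Q"
  proof (rule measure_eqI)
    fix A assume "A \<in> sets (distr \<kappa> Q snd)"
    then have A: "A \<in> sets borel" by (simp add: Q(2))
    have "emeasure (distr \<kappa> Q snd) A = emeasure \<kappa> (UNIV \<times> A)"
      using A by (subst emeasure_distr) (auto simp: Q(2) space sets measurable_cong_sets[OF sets refl] intro!: arg_cong[of _ _ "emeasure \<kappa>"])
    then show "emeasure (distr \<kappa> Q snd) A = emeasure Q A"
      using A by (simp add: emeasure snd_marginal Q.emeasure_eq_measure)
  qed simp
  ultimately have "\<kappa> \<in> couplings P Q"
    using sets unfolding couplings_def by simp
  moreover have "measure \<kappa> (A \<times> B) = m (A \<times> B)" if "A \<in> sets borel" "B \<in> sets borel" for A B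
    using emeasure[OF that] nonneg by (simp add: measure_def)
  ultimately show ?thesis by (rule that)
qed

section \<open>Kantorovich duality for sublinear costs\<close>

lemma couplings_measurable:
  assumes "\<kappa> \<in> couplings P Q"
  shows "fst \<in> measurable \<kappa> P" and "snd \<in> measurable \<kappa> Q"
  using assms unfolding couplings_def by (auto cong: measurable_cong_sets)

lemma couplings_fst:
  fixes f :: "'a \<Rightarrow> real"
  assumes \<kappa>: "\<kappa> \<in> couplings P Q" and f: "f \<in> borel_measurable P"
  shows "integrable \<kappa> (\<lambda>z. f (fst z)) \<longleftrightarrow> integrable P f" and "(\<integral>z. f (fst z) \<partial>\<kappa>) = (\<integral>x. f x \<partial>P)"
  using integrable_distr_eq[OF couplings_measurable(1)[OF \<kappa>] f] integral_distr[OF couplings_measurable(1)[OF \<kappa>] f] \<kappa>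
  unfolding couplings_def by auto

lemma couplings_snd:
  fixes f :: "'b \<Rightarrow> real"
  assumes \<kappa>: "\<kappa> \<in> couplings P Q" and f: "f \<in> borel_measurable Q"
  shows "integrable \<kappa> (\<lambda>z. f (snd z)) \<longleftrightarrow> integrable Q f" and "(\<integral>z. f (snd z) \<partial>\<kappa>) = (\<integral>x. f x \<partial>Q)"
  using integrable_distr_eq[OF couplings_measurable(2)[OF \<kappa>] f] integral_distr[OF couplings_measurable(2)[OF \<kappa>] f] \<kappa>
  unfolding couplings_def by auto

section \<open>Lipschitz functions and first moments\<close>

lemma lipschitz_constant_nonneg:
  fixes v :: "'a::euclidean_space \<Rightarrow> real"
  assumes "\<And>x y. \<bar>v x - v y\<bar> \<le> C * norm (x - y)"
  shows "0 \<le> C"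
  \<comment> \<open>A basis vector has norm 1, so at this point the bound reads
    \<open>\<bar>v b - v 0\<bar> \<le> C\<close>.\<close>
  using assms[of "SOME b. b \<in> Basis" 0] norm_Basis[OF SOME_Basis] by (auto simp: order_trans[OF abs_ge_zero])

lemma continuous_on_lipschitz_real:
  fixes v :: "'a::euclidean_space \<Rightarrow> real"
  assumes v: "\<And>x y. \<bar>v x - v y\<bar> \<le> C * norm (x - y)"
  shows "continuous_on UNIV v"
proof -
  have "C-lipschitz_on UNIV v"
    using v lipschitz_constant_nonneg[of v C] by (intro lipschitz_onI) (auto simp: dist_norm)
  then show ?thesis by (rule lipschitz_on_continuous_on)
qed

lemma integrable_lipschitz:
  fixes v :: "'a::euclidean_space \<Rightarrow> real"
  assumes P: "prob_space P" "sets P = sets borel" "integrable P (\<lambda>x. norm x)"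
    and v: "\<And>x y. \<bar>v x - v y\<bar> \<le> C * norm (x - y)"
  shows "integrable P v"
proof (rule Bochner_Integration.integrable_bound)
  interpret P: prob_space P by fact
  show "integrable P (\<lambda>x. \<bar>v 0\<bar> + C * norm x)" using P(3) by simp
  show "v \<in> borel_measurable P"
    using P(2) borel_measurable_continuous_onI[OF continuous_on_lipschitz_real[OF v]]
    by (simp cong: measurable_cong_sets)
  show "AE x in P. norm (v x) \<le> norm (\<bar>v 0\<bar> + C * norm x)"
  proof (rule AE_I2)
    fix x show "norm (v x) \<le> norm (\<bar>v 0\<bar> + C * norm x)"
      using v[of x 0] by simp
  qed
qed

text \<open>Using the one-sided bound for both orders of the arguments makes every potential
  Lipschitz, hence continuous and integrable under finite first moments.\<close>

lemma potential_diff: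
  fixes h v :: "'a::real_normed_vector \<Rightarrow> real"
  assumes h: "\<And>z. \<bar>h z\<bar> \<le> C * norm z" and v: "\<And>x y. v x - v y \<le> h (x - y)"
  shows "\<bar>v x - v y\<bar> \<le> C * norm (x - y)"
  using v[of x y] v[of y x] h[of "x - y"] h[of "y - x"]
  by (simp add: norm_minus_commute abs_le_iff)

section \<open>Duality for a subadditive, linearly bounded cost\<close>

context
  fixes P Q :: "'a::euclidean_space measure" and h :: "'a \<Rightarrow> real" and C :: real
  assumes P: "prob_space P" "sets P = sets borel" "integrable P (\<lambda>x. norm x)"
    and Q: "prob_space Q" "sets Q = sets borel" "integrable Q (\<lambda>x. norm x)"
    and h_add: "\<And>x y. h (x + y) \<le> h x + h y"
    and h_bound: "\<And>x. \<bar>h x\<bar> \<le> C * norm x"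
begin

lemma sublinear_diff: "\<bar>h x - h y\<bar> \<le> C * norm (x - y)"
proof (rule potential_diff[OF h_bound])
  show "h x - h y \<le> h (x - y)" for x y using h_add[of "x - y" y] by simp
qed

text \<open>The first moments of the two marginals dominate the cost.\<close>

lemma integrable_coupling_cost:
  assumes \<kappa>: "\<kappa> \<in> couplings P Q"
  shows "integrable \<kappa> (\<lambda>z. h (fst z - snd z))"
proof -
  have [measurable]: "fst \<in> borel_measurable \<kappa>" "snd \<in> borel_measurable \<kappa>"
    using couplings_measurable[OF \<kappa>] P(2) Q(2) by (simp_all cong: measurable_cong_sets)
  have [measurable]: "h \<in> borel_measurable borel"
    by (rule borel_measurable_continuous_onI[OF continuous_on_lipschitz_real[OF sublinear_diff]])
  have norm_int: "integrable \<kappa> (\<lambda>z. norm (fst z))" "integrable \<kappa> (\<lambda>z. norm (snd z))"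
    using couplings_fst(1)[OF \<kappa>, of norm] couplings_snd(1)[OF \<kappa>, of norm] P(2,3) Q(2,3)
    by (simp_all cong: measurable_cong_sets)
  show ?thesis
  proof (rule Bochner_Integration.integrable_bound)
    show "integrable \<kappa> (\<lambda>z. \<bar>C\<bar> * (norm (fst z) + norm (snd z)))" using norm_int by simp
    show "AE z in \<kappa>. norm (h (fst z - snd z)) \<le> norm (\<bar>C\<bar> * (norm (fst z) + norm (snd z)))"
    proof (rule AE_I2)
      fix z :: "'a \<times> 'a"
      have "\<bar>h (fst z - snd z)\<bar> \<le> C * norm (fst z - snd z)" by (rule h_bound)
      also have "\<dots> \<le> \<bar>C\<bar> * (norm (fst z) + norm (snd z))"
        by (intro mult_mono norm_triangle_ineq4) auto
      finally show "norm (h (fst z - snd z)) \<le> norm (\<bar>C\<bar> * (norm (fst z) + norm (snd z)))" by simp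
    qed
  qed simp
qed

text \<open>
  The infimal convolution of \<open>\<phi>\<close> with the cost separates \<open>\<phi>\<close> from \<open>- \<psi>\<close>, which reduces a pair of
  functions to a single potential.
\<close>

lemma pair_potential_nonneg:
  assumes dual: "\<And>v. (\<And>x y. v x - v y \<le> h (x - y)) \<Longrightarrow> (\<integral>x. v x \<partial>P) \<le> (\<integral>x. v x \<partial>Q)"
    and \<phi>: "integrable P \<phi>" and \<psi>: "integrable Q \<psi>" and t: "0 \<le> t"
    and le: "\<And>x y. 0 \<le> \<phi> x + \<psi> y + t * h (x - y)"
  shows "0 \<le> (\<integral>x. \<phi> x \<partial>P) + (\<integral>y. \<psi> y \<partial>Q)"
proof (cases "t = 0")
  case True
  interpret P: prob_space P by fact
  interpret Q: prob_space Q by fact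
  \<comment> \<open>With \<open>t = 0\<close> the variables separate, so the inequality can be
    integrated in one variable at a time.\<close>
  have "- \<psi> y \<le> \<phi> x" for x y
    using le[of x y] True by simp
  then have "- \<psi> y \<le> (\<integral>x. \<phi> x \<partial>P)" for y
    by (intro P.integral_ge_const[OF \<phi>] AE_I2)
  then have "- (\<integral>x. \<phi> x \<partial>P) \<le> (\<integral>y. \<psi> y \<partial>Q)"
    by (intro Q.integral_ge_const[OF \<psi>] AE_I2) (simp add: minus_le_iff)
  then show ?thesis by simp
next
  case False
  with t have t: "0 < t" by simp
  define u where "u y = (INF x. \<phi> x + t * h (x - y))" for y
  have le': "- \<psi> y \<le> \<phi> x + t * h (x - y)" for x y
    using le[of x y] by simp
  then have bdd: "bdd_below (range (\<lambda>x. \<phi> x + t * h (x - y)))" for y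
    by (intro bdd_belowI2)
  have u_le: "u y \<le> \<phi> x + t * h (x - y)" for x y
    unfolding u_def using bdd by (rule cINF_lower) simp
  have u_ge: "- \<psi> y \<le> u y" for y
    unfolding u_def using le' by (intro cINF_greatest) auto
  have u_diff: "u y \<le> u x + t * h (x - y)" for x y
  proof -
    have "u y - t * h (x - y) \<le> \<phi> z + t * h (z - x)" for z
    proof -
      have "t * h (z - y) \<le> t * h (z - x) + t * h (x - y)"
        using h_add[of "z - x" "x - y"] t by (simp flip: distrib_left)
      then show ?thesis using u_le[of y z] by simp
    qed
    then have "u y - t * h (x - y) \<le> u x"
      unfolding u_def[of x] by (intro cINF_greatest) auto
    then show ?thesis by simp
  qed
  \<comment> \<open>The sign exchanges the two arguments and the division removes the multiplier,
    which makes \<open>v\<close> an admissible potential.\<close>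
  define v where "v y = - u y / t" for y
  have v: "v x - v y \<le> h (x - y)" for x y
    using u_diff[of y x] t unfolding v_def by (simp add: field_simps)
  have vP: "integrable P v" and vQ: "integrable Q v"
    using integrable_lipschitz[OF P potential_diff[OF h_bound v]] integrable_lipschitz[OF Q potential_diff[OF h_bound v]]
    by auto
  have u_eq: "u = (\<lambda>y. - t * v y)"
    using t unfolding v_def by auto
  have uP: "integrable P u" and uQ: "integrable Q u"
    using vP vQ unfolding u_eq by simp_all
  have "- (\<integral>y. \<psi> y \<partial>Q) = (\<integral>y. - \<psi> y \<partial>Q)" by simp
  also have "\<dots> \<le> (\<integral>y. u y \<partial>Q)"
    using \<psi> uQ u_ge by (intro integral_mono) simp_all
  also have "\<dots> \<le> (\<integral>x. u x \<partial>P)"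
    using dual[OF v] t unfolding u_eq by simp
  \<comment> \<open>On the diagonal the cost vanishes, since \<open>h_bound\<close> forces
    \<open>h 0 = 0\<close>; hence \<open>u \<le> \<phi>\<close>.\<close>
  also have "\<dots> \<le> (\<integral>x. \<phi> x \<partial>P)"
    using u_le[of x x for x] h_bound[of 0] \<phi> uP by (intro integral_mono) simp_all
  finally show ?thesis by simp
qed

text \<open>A functional below \<open>p\<close> satisfies an integral bound for every admissible
  triple, so positivity, the marginals and the sign of the cost all come from particular triples.
  Simple maps transfer the last of these from the functional to the measure.\<close>

theorem coupling_of_dual_inequality:
  assumes dual: "\<And>v. (\<And>x y. v x - v y \<le> h (x - y)) \<Longrightarrow> (\<integral>x. v x \<partial>P) \<le> (\<integral>x. v x \<partial>Q)"
  obtains \<kappa> where "\<kappa> \<in> couplings P Q" and "(\<integral>z. h (fst z - snd z) \<partial>\<kappa>) \<le> 0"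
proof -
  interpret P: prob_space P by fact
  interpret Q: prob_space Q by fact
  \<comment> \<open>Nonmeasurable functions are included on purpose: indicators of all subsets lie
    in \<open>V\<close>, so the content \<open>m\<close> is defined on every set.\<close>
  define V where "V = {f :: 'a \<times> 'a \<Rightarrow> real. \<exists>K. \<forall>x y. \<bar>f (x, y)\<bar> \<le> K * (1 + norm x + norm y)}"
  \<comment> \<open>The number \<open>t\<close> acts as a multiplier: it enlarges the admissible
    bound without adding to its value, which is how the cost is later bounded by 0.\<close>
  define U where "U f = {(\<integral>x. \<phi> x \<partial>P) + (\<integral>y. \<psi> y \<partial>Q) | \<phi> \<psi> t. integrable P \<phi> \<and> integrable Q \<psi> \<and> 0 \<le> t \<and>
      (\<forall>x y. f (x, y) \<le> \<phi> x + \<psi> y + t * h (x - y))}" for f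
  define p where "p f = Inf (U f)" for f
  have VI: "f \<in> V" if "\<And>x y. \<bar>f (x, y)\<bar> \<le> K * (1 + norm x + norm y)" for f K
    using that unfolding V_def by blast
  have VE: "\<exists>K. \<forall>x y. \<bar>f (x, y)\<bar> \<le> K * (1 + norm x + norm y)" if "f \<in> V" for f
    using that unfolding V_def by blast
  have UI: "(\<integral>x. \<phi> x \<partial>P) + (\<integral>y. \<psi> y \<partial>Q) \<in> U f"
    if "integrable P \<phi>" "integrable Q \<psi>" "0 \<le> t" "\<And>x y. f (x, y) \<le> \<phi> x + \<psi> y + t * h (x - y)" for f \<phi> \<psi> t
    using that unfolding U_def by blast
  have UE: "\<exists>\<phi> \<psi> t. a = (\<integral>x. \<phi> x \<partial>P) + (\<integral>y. \<psi> y \<partial>Q) \<and> integrable P \<phi> \<and> integrable Q \<psi> \<and> 0 \<le> t \<and>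
      (\<forall>x y. f (x, y) \<le> \<phi> x + \<psi> y + t * h (x - y))" if "a \<in> U f" for f a
    using that unfolding U_def by blast
  have V_add: "(\<lambda>z. f z + g z) \<in> V" if fg: "f \<in> V" "g \<in> V" for f g
  proof -
    obtain K L where K: "\<forall>x y. \<bar>f (x, y)\<bar> \<le> K * (1 + norm x + norm y)"
      and L: "\<forall>x y. \<bar>g (x, y)\<bar> \<le> L * (1 + norm x + norm y)"
      using VE[OF fg(1)] VE[OF fg(2)] by blast
    have "\<bar>f (x, y) + g (x, y)\<bar> \<le> (K + L) * (1 + norm x + norm y)" for x y
    proof -
      have "\<bar>f (x, y) + g (x, y)\<bar> \<le> K * (1 + norm x + norm y) + L * (1 + norm x + norm y)"
        using K[rule_format, of x y] L[rule_format, of x y] by linarith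
      then show ?thesis by (simp add: distrib_right)
    qed
    then show ?thesis by (rule VI)
  qed
  have V_scale: "(\<lambda>z. c * f z) \<in> V" if f: "f \<in> V" for f c
  proof -
    obtain K where K: "\<forall>x y. \<bar>f (x, y)\<bar> \<le> K * (1 + norm x + norm y)"
      using VE[OF f] by blast
    have "\<bar>c * f (x, y)\<bar> \<le> (\<bar>c\<bar> * K) * (1 + norm x + norm y)" for x y
      using mult_left_mono[OF K[rule_format, of x y] abs_ge_zero[of c]] by (simp add: abs_mult mult.assoc)
    then show ?thesis by (rule VI)
  qed
  have V_ind: "(indicator S :: 'a \<times> 'a \<Rightarrow> real) \<in> V" for S
    by (rule VI[of _ 1]) (simp add: indicator_def)
  have V_zero: "(\<lambda>z. 0) \<in> V" by (rule VI[of _ 0]) simp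
  have U_bdd: "bdd_below (U f)" if f: "f \<in> V" for f
  proof -
    obtain K where K: "\<forall>x y. \<bar>f (x, y)\<bar> \<le> K * (1 + norm x + norm y)"
      using VE[OF f] by blast
    \<comment> \<open>Moving the growth bound of \<open>f\<close> into the two marginal functions
      produces a pair to which \<open>pair_potential_nonneg\<close> applies. The resulting lower
      bound does not depend on the triple.\<close>
    have "- (K * (1 + (\<integral>x. norm x \<partial>P)) + K * (\<integral>y. norm y \<partial>Q)) \<le> a" if a: "a \<in> U f" for a
    proof -
      obtain \<phi> \<psi> t where *: "a = (\<integral>x. \<phi> x \<partial>P) + (\<integral>y. \<psi> y \<partial>Q)" "integrable P \<phi>" "integrable Q \<psi>" "0 \<le> t"
        "\<And>x y. f (x, y) \<le> \<phi> x + \<psi> y + t * h (x - y)"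
        using UE[OF a] by blast
      have "0 \<le> (\<integral>x. \<phi> x + K * (1 + norm x) \<partial>P) + (\<integral>y. \<psi> y + K * norm y \<partial>Q)"
      proof (rule pair_potential_nonneg[OF dual _ _ *(4)])
        fix x y
        show "0 \<le> (\<phi> x + K * (1 + norm x)) + (\<psi> y + K * norm y) + t * h (x - y)"
          using K[rule_format, of x y] *(5)[of x y] by (simp add: algebra_simps abs_le_iff)
      qed (use * P(3) Q(3) in auto)
      then show ?thesis using * P(3) Q(3) by (simp add: P.prob_space)
    qed
    then show ?thesis by (rule bdd_belowI)
  qed
  have U_nonempty: "U f \<noteq> {}" if f: "f \<in> V" for f
  proof -
    obtain K where K: "\<forall>x y. \<bar>f (x, y)\<bar> \<le> K * (1 + norm x + norm y)"
      using VE[OF f] by blast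
    have "f (x, y) \<le> K * (1 + norm x) + K * norm y + 0 * h (x - y)" for x y
      using K[rule_format, of x y] by (simp add: algebra_simps abs_le_iff)
    from UI[OF _ _ order_refl this] show ?thesis using P(3) Q(3) by auto
  qed
  have p_le: "p f \<le> a" if "f \<in> V" "a \<in> U f" for f a
    unfolding p_def using that(2) U_bdd[OF that(1)] by (rule cInf_lower)
  have le_p: "b \<le> p f" if "f \<in> V" "\<And>a. a \<in> U f \<Longrightarrow> b \<le> a" for f b
    unfolding p_def using U_nonempty[OF that(1)] that(2) by (rule cInf_greatest)
  have p_add: "p (\<lambda>z. f z + g z) \<le> p f + p g" if fg: "f \<in> V" "g \<in> V" for f g
  proof -
    have *: "p (\<lambda>z. f z + g z) \<le> a + b" if a: "a \<in> U f" and b: "b \<in> U g" for a b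
    proof -
      obtain \<phi> \<psi> t where 1: "a = (\<integral>x. \<phi> x \<partial>P) + (\<integral>y. \<psi> y \<partial>Q)" "integrable P \<phi>" "integrable Q \<psi>" "0 \<le> t"
        "\<And>x y. f (x, y) \<le> \<phi> x + \<psi> y + t * h (x - y)"
        using UE[OF a] by blast
      obtain \<phi>' \<psi>' t' where 2: "b = (\<integral>x. \<phi>' x \<partial>P) + (\<integral>y. \<psi>' y \<partial>Q)" "integrable P \<phi>'" "integrable Q \<psi>'" "0 \<le> t'"
        "\<And>x y. g (x, y) \<le> \<phi>' x + \<psi>' y + t' * h (x - y)"
        using UE[OF b] by blast
      have "f (x, y) + g (x, y) \<le> (\<phi> x + \<phi>' x) + (\<psi> y + \<psi>' y) + (t + t') * h (x - y)" for x y
        using 1(5)[of x y] 2(5)[of x y] by (simp add: algebra_simps)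
      then have "(\<integral>x. \<phi> x + \<phi>' x \<partial>P) + (\<integral>y. \<psi> y + \<psi>' y \<partial>Q) \<in> U (\<lambda>z. f z + g z)"
        using 1 2 by (intro UI[of _ _ "t + t'"]) simp_all
      from p_le[OF V_add[OF fg] this] show ?thesis using 1 2 by simp
    qed
    have "p (\<lambda>z. f z + g z) - p g \<le> a" if "a \<in> U f" for a
      using le_p[OF fg(2), of "p (\<lambda>z. f z + g z) - a"] *[OF that] by (simp add: diff_le_eq add.commute)
    then show ?thesis
      using le_p[OF fg(1), of "p (\<lambda>z. f z + g z) - p g"] by (simp add: diff_le_eq)
  qed
  have p_scale: "p (\<lambda>z. c * f z) \<le> c * p f" if f: "f \<in> V" and c: "0 < c" for f c
  proof -
    have "p (\<lambda>z. c * f z) / c \<le> a" if a: "a \<in> U f" for a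
    proof -
      obtain \<phi> \<psi> t where 1: "a = (\<integral>x. \<phi> x \<partial>P) + (\<integral>y. \<psi> y \<partial>Q)" "integrable P \<phi>" "integrable Q \<psi>" "0 \<le> t"
        "\<And>x y. f (x, y) \<le> \<phi> x + \<psi> y + t * h (x - y)"
        using UE[OF a] by blast
      have "c * f (x, y) \<le> c * \<phi> x + c * \<psi> y + (c * t) * h (x - y)" for x y
        using mult_left_mono[OF 1(5)[of x y], of c] c by (simp add: algebra_simps)
      then have "(\<integral>x. c * \<phi> x \<partial>P) + (\<integral>y. c * \<psi> y \<partial>Q) \<in> U (\<lambda>z. c * f z)"
        using 1 c by (intro UI[of _ _ "c * t"]) simp_all
      from p_le[OF V_scale[OF f] this] show ?thesis using 1 c by (simp add: field_simps)
    qed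
    then have "p (\<lambda>z. c * f z) / c \<le> p f" by (rule le_p[OF f])
    then show ?thesis using c by (simp add: field_simps)
  qed
  obtain L where L_add: "\<And>f g. f \<in> V \<Longrightarrow> g \<in> V \<Longrightarrow> L (\<lambda>z. f z + g z) = L f + L g"
    and L_scale: "\<And>f c. f \<in> V \<Longrightarrow> L (\<lambda>z. c * f z) = c * L f" and L_p: "\<And>f. f \<in> V \<Longrightarrow> L f \<le> p f"
    using hahn_banach_function_space[of V p] V_zero V_add V_scale p_add p_scale by blast
  have L_le: "L f \<le> (\<integral>x. \<phi> x \<partial>P) + (\<integral>y. \<psi> y \<partial>Q)"
    if "f \<in> V" "integrable P \<phi>" "integrable Q \<psi>" "0 \<le> t" "\<And>x y. f (x, y) \<le> \<phi> x + \<psi> y + t * h (x - y)" for f \<phi> \<psi> t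
    using L_p[OF that(1)] p_le[OF that(1) UI[OF that(2-5)]] by linarith
  have L_sum: "(\<lambda>z. \<Sum>i\<in>I. f i z) \<in> V \<and> L (\<lambda>z. \<Sum>i\<in>I. f i z) = (\<Sum>i\<in>I. L (f i))"
    if "finite I" "\<And>i. f i \<in> V" for f :: "'a \<times> 'a \<Rightarrow> 'a \<times> 'a \<Rightarrow> real" and I
    using that(1)
  proof (induction I rule: finite_induct)
    case empty
    show ?case using V_zero L_scale[OF V_zero, of 0] by simp
  next
    case (insert i I)
    then show ?case using V_add[OF that(2)[of i]] L_add[OF that(2)[of i]] by simp
  qed
  define m where "m S = L (indicator S)" for S
  have "\<exists>\<kappa>\<in>couplings P Q. \<forall>A\<in>sets borel. \<forall>B\<in>sets borel. measure \<kappa> (A \<times> B) = m (A \<times> B)"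
  proof (rule coupling_of_additive_content[OF P(1,2) Q(1,2)])
    fix S
    \<comment> \<open>The zero triple dominates the negative of an indicator.\<close>
    have "L (\<lambda>z. (-1) * indicator S z) \<le> (\<integral>x. 0 \<partial>P) + (\<integral>y. 0 \<partial>Q)"
      by (rule L_le[of _ _ _ 0, OF V_scale[OF V_ind]]) simp_all
    then show "0 \<le> m S" unfolding L_scale[OF V_ind] m_def by simp
  next
    fix S T :: "('a \<times> 'a) set" assume "S \<inter> T = {}"
    then have "indicator (S \<union> T) = (\<lambda>z. indicator S z + indicator T z :: real)"
      by (auto simp: fun_eq_iff indicator_def)
    then show "m (S \<union> T) = m S + m T"
      unfolding m_def using L_add[OF V_ind V_ind] by simp
  next
    fix A :: "'a set" assume A: "A \<in> sets borel"
    \<comment> \<open>Bounding the indicator and also its negative turns the upper bound into the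
      exact marginal.\<close>
    have "L (indicator (A \<times> UNIV)) \<le> (\<integral>x. indicator A x \<partial>P) + (\<integral>y. 0 \<partial>Q)"
      by (rule L_le[of _ _ _ 0, OF V_ind]) (use A P(2) in \<open>auto simp: P.emeasure_eq_measure indicator_times\<close>)
    moreover have "L (\<lambda>z. (-1) * indicator (A \<times> UNIV) z) \<le> (\<integral>x. - indicator A x \<partial>P) + (\<integral>y. 0 \<partial>Q)"
      by (rule L_le[of _ _ _ 0, OF V_scale[OF V_ind]])
        (use A P(2) in \<open>auto simp: P.emeasure_eq_measure indicator_times\<close>)
    ultimately show "m (A \<times> UNIV) = measure P A"
      unfolding L_scale[OF V_ind] m_def using A P(2) by simp
  next
    fix A :: "'a set" assume A: "A \<in> sets borel"
    have "L (indicator (UNIV \<times> A)) \<le> (\<integral>x. 0 \<partial>P) + (\<integral>y. indicator A y \<partial>Q)"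
      by (rule L_le[of _ _ _ 0, OF V_ind]) (use A Q(2) in \<open>auto simp: Q.emeasure_eq_measure indicator_times\<close>)
    moreover have "L (\<lambda>z. (-1) * indicator (UNIV \<times> A) z) \<le> (\<integral>x. 0 \<partial>P) + (\<integral>y. - indicator A y \<partial>Q)"
      by (rule L_le[of _ _ _ 0, OF V_scale[OF V_ind]])
        (use A Q(2) in \<open>auto simp: Q.emeasure_eq_measure indicator_times\<close>)
    ultimately show "m (UNIV \<times> A) = measure Q A"
      unfolding L_scale[OF V_ind] m_def using A Q(2) by simp
  qed blast
  then obtain \<kappa> where \<kappa>: "\<kappa> \<in> couplings P Q"
    and \<kappa>_m: "\<And>A B. A \<in> sets borel \<Longrightarrow> B \<in> sets borel \<Longrightarrow> measure \<kappa> (A \<times> B) = m (A \<times> B)"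
    by blast
  interpret K: prob_space \<kappa> using \<kappa> unfolding couplings_def by simp
  have sets_\<kappa>: "sets \<kappa> = sets (borel \<Otimes>\<^sub>M borel)"
    using \<kappa> sets_pair_measure_cong[OF P(2) Q(2)] unfolding couplings_def by simp
  have P_meas: "f \<in> borel_measurable P" if "f \<in> borel_measurable borel" for f :: "'a \<Rightarrow> real"
    using that P(2) by (simp cong: measurable_cong_sets)
  have Q_meas: "f \<in> borel_measurable Q" if "f \<in> borel_measurable borel" for f :: "'a \<Rightarrow> real"
    using that Q(2) by (simp cong: measurable_cong_sets)
  note h_int = integrable_coupling_cost[OF \<kappa>]
  \<comment> \<open>The functional and the integral are known to agree only on combinations of
    rectangle indicators, so the cost is evaluated at a finitely valued \<open>T\<close> in place of
    the identity.\<close>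
  have simple: "(\<integral>z. h (fst z - snd z) \<partial>\<kappa>) \<le>
      2 * C * ((\<integral>x. norm (T x - x) \<partial>P) + (\<integral>y. norm (T y - y) \<partial>Q))"
    if T: "simple_function borel T" and TP: "integrable P (\<lambda>x. norm (T x - x))"
      and TQ: "integrable Q (\<lambda>x. norm (T x - x))" for T
  proof -
    have T_meas[measurable]: "T \<in> borel_measurable borel" using T by (rule borel_measurable_simple_function)
    have fin: "finite (range T)" using simple_functionD(1)[OF T] by simp
    define F where "F i z = h (fst i - snd i) * indicator (T -` {fst i} \<times> T -` {snd i}) z" for i z :: "'a \<times> 'a"
    define I where "I = range T \<times> range T"
    have finI: "finite I" using fin unfolding I_def by simp
    have T_vim: "T -` {a} \<in> sets borel" for a
      using measurable_sets[OF T_meas, of "{a}"] by simp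
    have F_V: "F i \<in> V" for i unfolding F_def[abs_def] using V_ind by (rule V_scale)
    \<comment> \<open>The level sets of \<open>T\<close> cut the product into finitely many disjoint
      rectangles, on each of which the discretised cost is constant.\<close>
    have F_sum: "(\<Sum>i\<in>I. F i z) = h (T (fst z) - T (snd z))" for z
    proof -
      have "(\<Sum>i\<in>I. F i z) = (\<Sum>i\<in>{(T (fst z), T (snd z))}. F i z)"
        using finI by (intro sum.mono_neutral_right) (auto simp: I_def F_def indicator_def split: if_splits)
      then show ?thesis by (simp add: F_def indicator_def mem_Times_iff)
    qed
    have rect_sets: "T -` {fst i} \<times> T -` {snd i} \<in> sets \<kappa>" for i
      unfolding sets_\<kappa> using T_vim T_vim by (rule pair_measureI)
    have F_int: "integrable \<kappa> (F i)" for i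
      unfolding F_def[abs_def] using rect_sets by (simp add: K.emeasure_eq_measure)
    have "(\<integral>z. h (T (fst z) - T (snd z)) \<partial>\<kappa>) = (\<Sum>i\<in>I. \<integral>z. F i z \<partial>\<kappa>)"
      unfolding F_sum[symmetric] using F_int by (rule Bochner_Integration.integral_sum)
    also have "\<dots> = (\<Sum>i\<in>I. L (F i))"
    proof (rule sum.cong)
      fix i
      have "(\<integral>z. F i z \<partial>\<kappa>) = h (fst i - snd i) * m (T -` {fst i} \<times> T -` {snd i})"
        unfolding F_def using \<kappa>_m[OF T_vim T_vim, of "fst i" "snd i"] rect_sets[of i]
        by (simp add: K.emeasure_eq_measure)
      also have "\<dots> = L (F i)" unfolding F_def[abs_def] m_def using L_scale[OF V_ind] by simp
      finally show "(\<integral>z. F i z \<partial>\<kappa>) = L (F i)" .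
    qed simp
    also have "\<dots> = L (\<lambda>z. h (T (fst z) - T (snd z)))"
      using L_sum[OF finI, of F, OF F_V] unfolding F_sum by simp
    \<comment> \<open>Here the multiplier is 1: replacing \<open>T x\<close> and \<open>T y\<close>
      by \<open>x\<close> and \<open>y\<close> costs the two error terms, and the remaining
      \<open>h (x - y)\<close> is free.\<close>
    also have "\<dots> \<le> (\<integral>x. C * norm (T x - x) \<partial>P) + (\<integral>y. C * norm (T y - y) \<partial>Q)"
    proof (rule L_le[of _ _ _ 1])
      show "(\<lambda>z. h (T (fst z) - T (snd z))) \<in> V"
        using L_sum[OF finI, of F, OF F_V] unfolding F_sum by simp
      fix x y
      show "h (T (fst (x, y)) - T (snd (x, y))) \<le> C * norm (T x - x) + C * norm (T y - y) + 1 * h (x - y)"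
        using h_add[of "T x - x" "x - T y"] h_add[of "x - y" "y - T y"] h_bound[of "T x - x"]
          h_bound[of "y - T y"] by (simp add: norm_minus_commute abs_le_iff)
    qed (use TP TQ in auto)
    finally have 1: "(\<integral>z. h (T (fst z) - T (snd z)) \<partial>\<kappa>) \<le> C * ((\<integral>x. norm (T x - x) \<partial>P) + (\<integral>y. norm (T y - y) \<partial>Q))"
      by (simp add: distrib_left)
    have TP': "integrable \<kappa> (\<lambda>z. norm (T (fst z) - fst z))"
        "(\<integral>z. norm (T (fst z) - fst z) \<partial>\<kappa>) = (\<integral>x. norm (T x - x) \<partial>P)"
      using couplings_fst[OF \<kappa> P_meas[of "\<lambda>x. norm (T x - x)"]] TP by auto
    have TQ': "integrable \<kappa> (\<lambda>z. norm (T (snd z) - snd z))"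
        "(\<integral>z. norm (T (snd z) - snd z) \<partial>\<kappa>) = (\<integral>x. norm (T x - x) \<partial>Q)"
      using couplings_snd[OF \<kappa> Q_meas[of "\<lambda>x. norm (T x - x)"]] TQ by auto
    have hT_int: "integrable \<kappa> (\<lambda>z. h (T (fst z) - T (snd z)))"
      unfolding F_sum[symmetric] using F_int by simp
    \<comment> \<open>Returning from \<open>T\<close> to the identity under \<open>\<kappa>\<close>
      costs the same errors again, which explains the factor 2.\<close>
    have "(\<integral>z. h (fst z - snd z) \<partial>\<kappa>) \<le> (\<integral>z. h (T (fst z) - T (snd z)) +
        (C * norm (T (fst z) - fst z) + C * norm (T (snd z) - snd z)) \<partial>\<kappa>)"
    proof (rule integral_mono[OF h_int])
      show "integrable \<kappa> (\<lambda>z. h (T (fst z) - T (snd z)) +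
          (C * norm (T (fst z) - fst z) + C * norm (T (snd z) - snd z)))"
        using hT_int TP' TQ' by simp
      fix z :: "'a \<times> 'a"
      show "h (fst z - snd z) \<le> h (T (fst z) - T (snd z)) +
          (C * norm (T (fst z) - fst z) + C * norm (T (snd z) - snd z))"
        using h_add[of "fst z - T (fst z)" "T (fst z) - snd z"] h_add[of "T (fst z) - T (snd z)" "T (snd z) - snd z"]
          h_bound[of "fst z - T (fst z)"] h_bound[of "T (snd z) - snd z"]
        by (simp add: norm_minus_commute abs_le_iff)
    qed
    also have "\<dots> = (\<integral>z. h (T (fst z) - T (snd z)) \<partial>\<kappa>) + C * ((\<integral>x. norm (T x - x) \<partial>P) + (\<integral>y. norm (T y - y) \<partial>Q))"
      using hT_int TP' TQ' by (simp add: distrib_left)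
    finally show ?thesis using 1 by simp
  qed
  \<comment> \<open>Simple maps converging pointwise to the identity; the bound
    \<open>2 * norm x\<close> gives the dominating function \<open>3 * norm x\<close> for the
    errors.\<close>
  obtain T :: "nat \<Rightarrow> 'a \<Rightarrow> 'a" where T: "\<And>i. simple_function borel (T i)"
    "\<And>x. (\<lambda>i. T i x) \<longlonglongrightarrow> x" "\<And>i x. norm (T i x) \<le> 2 * norm x"
    using borel_measurable_implies_sequence_metric[of "\<lambda>x::'a. x" borel 0] by auto
  have T_lim: "integrable M (\<lambda>x. norm (T i x - x))" "(\<lambda>i. \<integral>x. norm (T i x - x) \<partial>M) \<longlonglongrightarrow> 0"
    if M: "sets M = sets borel" "integrable M (\<lambda>x. norm x)" for M i
  proof -
    have T_meas: "(\<lambda>x. norm (T i x - x)) \<in> borel_measurable M" for i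
      using borel_measurable_simple_function[OF T(1)[of i]] M(1) by (simp cong: measurable_cong_sets)
    have T_bound: "norm (T i x - x) \<le> 3 * norm x" for i x
      using norm_triangle_ineq4[of "T i x" x] T(3)[of i x] by linarith
    have lim: "(\<lambda>i. norm (T i x - x)) \<longlonglongrightarrow> 0" for x
      using T(2)[of x] by (simp add: tendsto_norm_zero LIM_zero)
    show "integrable M (\<lambda>x. norm (T i x - x))"
      by (rule Bochner_Integration.integrable_bound[of M "\<lambda>x. 3 * norm x"]) (use M(2) T_meas T_bound in auto)
    have "(\<lambda>i. \<integral>x. norm (T i x - x) \<partial>M) \<longlonglongrightarrow> (\<integral>x. 0 \<partial>M)"
      by (rule integral_dominated_convergence[where w = "\<lambda>x. 3 * norm x"]) (use M(2) T_meas T_bound lim in auto)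
    then show "(\<lambda>i. \<integral>x. norm (T i x - x) \<partial>M) \<longlonglongrightarrow> 0" by simp
  qed
  have "(\<lambda>i. 2 * C * ((\<integral>x. norm (T i x - x) \<partial>P) + (\<integral>y. norm (T i y - y) \<partial>Q))) \<longlonglongrightarrow> 2 * C * (0 + 0)"
    by (intro tendsto_intros T_lim P Q)
  then have "(\<integral>z. h (fst z - snd z) \<partial>\<kappa>) \<le> 2 * C * (0 + 0)"
    by (rule LIMSEQ_le_const) (use simple[OF T(1) T_lim(1)[OF P(2,3)] T_lim(1)[OF Q(2,3)]] in auto)
  with \<kappa> that show ?thesis by simp
qed

end

section \<open>Smooth approximation of potentials\<close>

text \<open>Squaring removes the kink at 0, where the difference quotient is at most
  \<open>\<bar>t\<bar>\<close>. This gives the differentiability of the mollifying kernel.\<close>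

lemma DERIV_pos_part_square:
  "((\<lambda>s::real. (max 0 s)\<^sup>2) has_field_derivative 2 * max 0 s) (at s)"
proof -
  consider "s > 0" | "s < 0" | "s = 0" by linarith
  then show ?thesis
  proof cases
    case 1
    have "((\<lambda>s::real. s\<^sup>2) has_field_derivative 2 * max 0 s) (at s)"
      using 1 by (auto intro!: derivative_eq_intros)
    then show ?thesis
      by (rule has_field_derivative_transform_within_open[where S = "{0<..}"]) (use 1 in auto)
  next
    case 2
    have "((\<lambda>s::real. 0) has_field_derivative 2 * max 0 s) (at s)"
      using 2 by simp
    then show ?thesis
      by (rule has_field_derivative_transform_within_open[where S = "{..<0}"]) (use 2 in auto)
  next
    case 3
    have "((\<lambda>t::real. (max 0 t)\<^sup>2 / t) \<longlongrightarrow> 0) (at 0)"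
    proof (rule Lim_null_comparison)
      show "\<forall>\<^sub>F t in at 0. norm ((max 0 t)\<^sup>2 / t) \<le> \<bar>t::real\<bar>"
        by (auto simp: max_def power2_eq_square intro!: always_eventually)
      show "((\<lambda>t::real. \<bar>t\<bar>) \<longlongrightarrow> 0) (at 0)" by (auto intro!: tendsto_eq_intros)
    qed
    then show ?thesis using 3 by (simp add: has_field_derivative_iff)
  qed
qed

text \<open>Averaging translates of \<open>v\<close> against a kernel supported in the ball of
  radius \<open>e\<close> preserves the one-sided bound, because a common shift leaves
  \<open>x - y\<close> unchanged, and moves each value by at most \<open>C * e\<close>.\<close>

lemma smooth_approximation:
  fixes v h :: "'a::euclidean_space \<Rightarrow> real"
  assumes lip: "\<And>x y. \<bar>v x - v y\<bar> \<le> C * norm (x - y)"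
    and vh: "\<And>x y. v x - v y \<le> h (x - y)" and e: "0 < e"
  obtains w where "\<And>x. w differentiable (at x)" and "\<And>x y. w x - w y \<le> h (x - y)"
    and "\<And>x. \<bar>w x - v x\<bar> \<le> C * e"
proof -
  note v_cont = continuous_on_lipschitz_real[OF lip] and C = lipschitz_constant_nonneg[OF lip]
  have v_comp: "continuous_on S (\<lambda>x. v (f x))" if "continuous_on S f" for f :: "'b::topological_space \<Rightarrow> 'a" and S
    using continuous_on_compose2[OF v_cont that] by simp
  \<comment> \<open>An explicit bump with a continuous first derivative, positive exactly on the
    open ball of radius \<open>e\<close>.\<close>
  define \<rho> where "\<rho> z = (max 0 (e\<^sup>2 - (norm z)\<^sup>2))\<^sup>2" for z :: 'a
  have \<rho>_nonneg: "0 \<le> \<rho> z" for z unfolding \<rho>_def by simp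
  have \<rho>_zero: "\<rho> z = 0" if "e \<le> norm z" for z
    using power_mono[OF that, of 2] e unfolding \<rho>_def by simp
  have \<rho>_cont: "continuous_on S (\<lambda>x. \<rho> (f x))" if "continuous_on S f" for f :: "'b::topological_space \<Rightarrow> 'a" and S
    unfolding \<rho>_def using that by (intro continuous_intros)
  have \<rho>_int: "integrable lborel (\<lambda>z. \<rho> z * f z)" if f: "continuous_on UNIV f" for f :: "'a \<Rightarrow> real"
  proof -
    have "integrable lborel (\<lambda>z. indicator (cball 0 e) z *\<^sub>R (\<rho> z * f z))"
      using continuous_on_subset[OF f] by (intro borel_integrable_compact continuous_intros \<rho>_cont) auto
    also have "(\<lambda>z. indicator (cball 0 e) z *\<^sub>R (\<rho> z * f z)) = (\<lambda>z. \<rho> z * f z)"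
      using \<rho>_zero by (auto simp: indicator_def fun_eq_iff)
    finally show ?thesis .
  qed
  define Z where "Z = (\<integral>z. \<rho> z \<partial>lborel)"
  have Z: "0 < Z"
  proof -
    have "Z \<noteq> 0"
    proof
      assume "Z = 0"
      then have "AE z in lborel. \<rho> z = 0"
        using \<rho>_int[of "\<lambda>_. 1"] \<rho>_nonneg unfolding Z_def
        by (subst (asm) integral_nonneg_eq_0_iff_AE) auto
      moreover have "\<rho> z \<noteq> 0" if "norm z < e" for z
        using power_strict_mono[OF that, of 2] unfolding \<rho>_def by simp
      ultimately have "AE z in lborel. z \<notin> ball (0::'a) e"
        by (auto elim!: eventually_mono)
      then have "emeasure lborel (ball (0::'a) e) = 0"
        by (subst (asm) AE_iff_measurable[of "ball 0 e"]) auto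
      then have "measure lborel (ball (0::'a) e) = 0" by (simp add: measure_def)
      then show False using content_ball_pos[OF e, of "0::'a"] by simp
    qed
    moreover have "0 \<le> Z" unfolding Z_def using \<rho>_nonneg by simp
    ultimately show ?thesis by simp
  qed
  define W where "W x = (\<integral>z. \<rho> z * v (x + z) \<partial>lborel)" for x
  have W_int: "integrable lborel (\<lambda>z. \<rho> z * v (x + z))" for x
    by (intro \<rho>_int v_comp continuous_intros)
  have W_diff: "W differentiable (at x0)" for x0
  proof -
    \<comment> \<open>One box contains the support of \<open>f x\<close> for every \<open>x\<close>
      within distance 1 of \<open>x0\<close>, so differentiation under the integral happens over a
      fixed compact set.\<close>
    have "bounded (cball x0 (1 + e))" by simp
    then obtain c where c: "cball x0 (1 + e) \<subseteq> cbox (- c) c"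
      using bounded_subset_cbox_symmetric by blast
    define f where "f x y = \<rho> (y - x) * v y" for x y
    \<comment> \<open>The factor 4 collects a 2 from the square and a 2 from the squared norm; the
      two minus signs cancel.\<close>
    define f' where "f' x y = (v y * (4 * max 0 (e\<^sup>2 - (norm (y - x))\<^sup>2))) *\<^sub>R blinfun_inner_left (y - x)" for x y
    have f_cont: "continuous_on S (f x)" for S x
      unfolding f_def by (intro continuous_intros \<rho>_cont v_comp)
    have W_eq: "integral (cbox (- c) c) (f x) = W x" if x: "x \<in> ball x0 1" for x
    proof -
      have supp: "f x y = 0" if "y \<notin> cbox (- c) c" for y
      proof -
        have "1 + e \<le> dist x0 y" using that c by force
        also have "\<dots> \<le> dist x0 x + dist x y" by (rule dist_triangle)
        finally have "e \<le> norm (y - x)" using x by (simp add: dist_norm norm_minus_commute)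
        then show ?thesis unfolding f_def using \<rho>_zero by simp
      qed
      have "set_integrable lborel (cbox (- c) c) (f x)"
        unfolding set_integrable_def by (intro borel_integrable_compact compact_cbox f_cont)
      then have "integral (cbox (- c) c) (f x) = (LINT y:cbox (- c) c|lborel. f x y)"
        by (rule set_borel_integral_eq_integral(2)[symmetric])
      also have "\<dots> = (\<integral>y. f x y \<partial>lborel)"
        unfolding set_lebesgue_integral_def using supp
        by (intro Bochner_Integration.integral_cong) (auto simp: indicator_def)
      \<comment> \<open>The substitution \<open>y = x + z\<close> shows that the variable of
        differentiation may sit in the smooth kernel instead of the merely Lipschitz
        \<open>v\<close>.\<close>
      also have "\<dots> = (\<integral>y. f x y \<partial>distr lborel borel ((+) x))"
        by (simp add: lborel_distr_plus)
      also have "\<dots> = (\<integral>z. f x (x + z) \<partial>lborel)"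
        using f_cont by (intro integral_distr) (auto intro: borel_measurable_continuous_onI)
      finally show ?thesis unfolding W_def f_def by simp
    qed
    have "((\<lambda>x. integral (cbox (- c) c) (f x)) has_derivative integral (cbox (- c) c) (f' x0)) (at x0 within ball x0 1)"
    proof (rule leibniz_rule)
      fix x y
      have "((\<lambda>x. e\<^sup>2 - (norm (y - x))\<^sup>2) has_derivative (\<lambda>k. 2 * (k \<bullet> (y - x)))) (at x within ball x0 1)"
        unfolding power2_norm_eq_inner
        by (auto intro!: derivative_eq_intros simp: inner_commute algebra_simps)
      from has_derivative_compose[OF this DERIV_pos_part_square[unfolded has_field_derivative_def]]
      have "((\<lambda>x. \<rho> (y - x)) has_derivative (\<lambda>k. 2 * max 0 (e\<^sup>2 - (norm (y - x))\<^sup>2) * (2 * (k \<bullet> (y - x))))) (at x within ball x0 1)"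
        unfolding \<rho>_def .
      from has_derivative_mult_left[OF this, of "v y"]
      show "((\<lambda>x. f x y) has_derivative blinfun_apply (f' x y)) (at x within ball x0 1)"
        unfolding f_def by (rule has_derivative_eq_rhs)
          (auto simp: fun_eq_iff f'_def blinfun.scaleR_left mult_ac)
      show "f x integrable_on cbox (- c) c" by (intro integrable_continuous f_cont)
      show "continuous_on (ball x0 1 \<times> cbox (- c) c) (\<lambda>(x, y). f' x y)"
        unfolding f'_def split_beta
        by (intro continuous_intros v_comp bounded_linear.continuous_on[OF bounded_linear_blinfun_inner_left])
    qed auto
    then have "((\<lambda>x. integral (cbox (- c) c) (f x)) has_derivative integral (cbox (- c) c) (f' x0)) (at x0)"
      by (subst (asm) at_within_open) auto
    then have "(W has_derivative integral (cbox (- c) c) (f' x0)) (at x0)"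
      by (rule has_derivative_transform_within_open[where s = "ball x0 1"]) (use W_eq in auto)
    then show ?thesis unfolding differentiable_def by blast
  qed
  show ?thesis
  proof (rule that[of "\<lambda>x. W x / Z"])
    show "(\<lambda>x. W x / Z) differentiable at x" for x
      using W_diff[of x] Z by (intro differentiable_divide) auto
    fix x y
    have "W x - W y = (\<integral>z. \<rho> z * v (x + z) - \<rho> z * v (y + z) \<partial>lborel)"
      unfolding W_def using W_int by simp
    also have "\<dots> \<le> (\<integral>z. \<rho> z * h (x - y) \<partial>lborel)"
    proof (rule integral_mono)
      fix z show "\<rho> z * v (x + z) - \<rho> z * v (y + z) \<le> \<rho> z * h (x - y)"
        using mult_left_mono[OF vh[of "x + z" "y + z"] \<rho>_nonneg[of z]] by (simp add: right_diff_distrib)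
    qed (use W_int \<rho>_int[of "\<lambda>_. h (x - y)"] in auto)
    also have "\<dots> = Z * h (x - y)" unfolding Z_def by simp
    finally show "W x / Z - W y / Z \<le> h (x - y)" using Z by (simp add: field_simps)
  next
    fix x
    have "\<bar>W x - Z * v x\<bar> = \<bar>\<integral>z. \<rho> z * v (x + z) - \<rho> z * v x \<partial>lborel\<bar>"
      unfolding W_def Z_def using W_int \<rho>_int[of "\<lambda>_. v x"] by simp
    also have "\<dots> \<le> (\<integral>z. \<bar>\<rho> z * v (x + z) - \<rho> z * v x\<bar> \<partial>lborel)"
      by (rule integral_abs_bound)
    also have "\<dots> \<le> (\<integral>z. \<rho> z * (C * e) \<partial>lborel)"
    proof (rule integral_mono)
      fix z
      show "\<bar>\<rho> z * v (x + z) - \<rho> z * v x\<bar> \<le> \<rho> z * (C * e)"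
      proof (cases "e \<le> norm z")
        case True
        then show ?thesis by (simp add: \<rho>_zero)
      next
        case False
        have "\<bar>v (x + z) - v x\<bar> \<le> C * norm z" using lip[of "x + z" x] by simp
        also have "\<dots> \<le> C * e" using False C by (intro mult_left_mono) auto
        finally have "\<rho> z * \<bar>v (x + z) - v x\<bar> \<le> \<rho> z * (C * e)"
          using \<rho>_nonneg by (rule mult_left_mono)
        then show ?thesis using \<rho>_nonneg[of z] by (simp add: abs_mult flip: right_diff_distrib)
      qed
    qed (use W_int \<rho>_int[of "\<lambda>_. C * e"] \<rho>_int[of "\<lambda>_. v x"] in auto)
    also have "\<dots> = Z * (C * e)" unfolding Z_def by simp
    finally have *: "\<bar>W x - Z * v x\<bar> \<le> Z * (C * e)" .
    have "W x / Z - v x = (W x - Z * v x) / Z" using Z by (simp add: field_simps)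
    then show "\<bar>W x / Z - v x\<bar> \<le> C * e"
      using * Z by (simp add: abs_divide divide_le_eq mult.commute)
  qed
qed

section \<open>The gradient set and its support function\<close>

lemma mult_le_max_of_between:
  fixes s \<gamma> r :: real
  assumes "\<gamma> \<le> r" "r \<le> 1"
  shows "r * s \<le> max s (\<gamma> * s)"
  using assms mult_right_mono[of r 1 s] mult_right_mono_neg[of \<gamma> r s]
  by (cases "0 \<le> s") (auto simp: max_def)

definition support_cost :: "'a::euclidean_space measure \<Rightarrow> real \<Rightarrow> 'a \<Rightarrow> real" where
  "support_cost lam \<gamma> z = (\<integral>a. max (a \<bullet> z) (\<gamma> * (a \<bullet> z)) \<partial>lam)"

context
  fixes lam :: "'a::euclidean_space measure" and \<gamma> :: real
  assumes lam: "integrable lam (\<lambda>a. a)" and \<gamma>: "0 \<le> \<gamma>" "\<gamma> \<le> 1"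
begin

lemma support_cost_integrable: "integrable lam (\<lambda>a. max (a \<bullet> z) (\<gamma> * (a \<bullet> z)))"
  using lam by simp

lemma support_cost_subadditive: "support_cost lam \<gamma> (x + y) \<le> support_cost lam \<gamma> x + support_cost lam \<gamma> y"
proof -
  have "support_cost lam \<gamma> (x + y) \<le>
      (\<integral>a. max (a \<bullet> x) (\<gamma> * (a \<bullet> x)) + max (a \<bullet> y) (\<gamma> * (a \<bullet> y)) \<partial>lam)"
    unfolding support_cost_def
    by (intro integral_mono Bochner_Integration.integrable_add support_cost_integrable)
      (auto simp: max_def inner_add_right algebra_simps)
  also have "\<dots> = support_cost lam \<gamma> x + support_cost lam \<gamma> y"
    unfolding support_cost_def by (intro Bochner_Integration.integral_add support_cost_integrable)
  finally show ?thesis .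
qed

lemma support_cost_scale:
  assumes "0 \<le> t"
  shows "support_cost lam \<gamma> (t *\<^sub>R z) = t * support_cost lam \<gamma> z"
proof -
  have "max (a \<bullet> (t *\<^sub>R z)) (\<gamma> * (a \<bullet> (t *\<^sub>R z))) = t * max (a \<bullet> z) (\<gamma> * (a \<bullet> z))" for a
    using assms by (simp add: max_mult_distrib_left mult.left_commute)
  then show ?thesis unfolding support_cost_def by simp
qed

lemma support_cost_bound: "\<bar>support_cost lam \<gamma> z\<bar> \<le> (\<integral>a. norm a \<partial>lam) * norm z"
proof -
  have "\<bar>support_cost lam \<gamma> z\<bar> \<le> (\<integral>a. \<bar>max (a \<bullet> z) (\<gamma> * (a \<bullet> z))\<bar> \<partial>lam)"
    unfolding support_cost_def by (rule integral_abs_bound)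
  also have "\<dots> \<le> (\<integral>a. norm a * norm z \<partial>lam)"
  proof (rule integral_mono)
    fix a
    have "\<bar>\<gamma> * (a \<bullet> z)\<bar> \<le> \<bar>a \<bullet> z\<bar>"
      using \<gamma> by (simp add: abs_mult mult_left_le_one_le)
    then show "\<bar>max (a \<bullet> z) (\<gamma> * (a \<bullet> z))\<bar> \<le> norm a * norm z"
      using Cauchy_Schwarz_ineq2[of a z] by linarith
  qed (use lam in auto)
  finally show ?thesis by simp
qed

text \<open>For \<open>\<gamma>\<close> in the unit interval, \<open>max s (\<gamma> * s)\<close> is
  the positive part of \<open>s\<close> minus \<open>\<gamma>\<close> times its negative part. With
  \<open>\<gamma> = 0\<close> the cost integrates the positive part, so the formula has the shape of
  the dominance condition.\<close>

lemma support_cost_pos_neg_parts: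
  "support_cost lam \<gamma> z = support_cost lam 0 z - \<gamma> * support_cost lam 0 (- z)"
proof -
  have "support_cost lam \<gamma> z = (\<integral>a. max (a \<bullet> z) 0 - \<gamma> * max (a \<bullet> (- z)) 0 \<partial>lam)"
    unfolding support_cost_def using \<gamma>
    by (intro Bochner_Integration.integral_cong) (auto simp: max_def mult_le_0_iff mult_le_cancel_right1 zero_le_mult_iff)
  also have "\<dots> = support_cost lam 0 z - \<gamma> * support_cost lam 0 (- z)"
    unfolding support_cost_def using lam by simp
  finally show ?thesis .
qed

end

section \<open>The gradient set, its closure, and potentials with gradients in it\<close>

lemma gradient_integrand_integrable:
  fixes lam :: "(real ^ 'n) measure"
  assumes lam: "integrable lam (\<lambda>a. a)" and "0 \<le> \<gamma>"
    and r: "r \<in> borel_measurable lam" "\<forall>a\<in>space lam. \<gamma> \<le> r a \<and> r a \<le> 1"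
  shows "integrable lam (\<lambda>a. r a *\<^sub>R a)"
proof (rule Bochner_Integration.integrable_bound[OF lam])
  show "(\<lambda>a. r a *\<^sub>R a) \<in> borel_measurable lam"
    using r(1) borel_measurable_integrable[OF lam] by (rule borel_measurable_scaleR)
  show "AE a in lam. norm (r a *\<^sub>R a) \<le> norm a"
    using r(2) \<open>0 \<le> \<gamma>\<close> by (intro AE_I2) (force intro: mult_left_le_one_le)
qed

context
  fixes lam :: "(real ^ 'n) measure" and \<gamma> :: real
  assumes lam: "integrable lam (\<lambda>a. a)" and \<gamma>: "0 \<le> \<gamma>" "\<gamma> \<le> 1"
begin

text \<open>The integrand is linear in the weight \<open>r a\<close>, so it is at most its value at
  an endpoint of the interval from \<open>\<gamma>\<close> to 1.\<close>

lemma gradient_set_inner_le: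
  assumes "g \<in> gradient_set lam \<gamma>"
  shows "z \<bullet> g \<le> support_cost lam \<gamma> z"
proof -
  obtain r where g: "g = (\<integral>a. r a *\<^sub>R a \<partial>lam)" and r: "r \<in> borel_measurable lam"
      "\<forall>a\<in>space lam. \<gamma> \<le> r a \<and> r a \<le> 1"
    using assms unfolding gradient_set_def by auto
  note int = gradient_integrand_integrable[OF lam \<gamma>(1) r]
  have "z \<bullet> g = (\<integral>a. z \<bullet> (r a *\<^sub>R a) \<partial>lam)"
    unfolding g using int by (rule integral_inner_right[symmetric])
  also have "\<dots> \<le> support_cost lam \<gamma> z"
    unfolding support_cost_def
  proof (rule integral_mono)
    fix a assume "a \<in> space lam"
    then show "z \<bullet> (r a *\<^sub>R a) \<le> max (a \<bullet> z) (\<gamma> * (a \<bullet> z))"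
      using r(2) mult_le_max_of_between[of \<gamma> "r a" "a \<bullet> z"] by (simp add: inner_commute)
  qed (rule integrable_inner_right[OF int] support_cost_integrable[OF lam \<gamma>])+
  finally show ?thesis .
qed

lemma gradient_set_attains:
  obtains g where "g \<in> gradient_set lam \<gamma>" and "z \<bullet> g = support_cost lam \<gamma> z"
proof -
  \<comment> \<open>The pointwise maximiser: full weight where \<open>a \<bullet> z\<close> is
    nonnegative, the least weight elsewhere.\<close>
  define r where "r a = (if 0 \<le> a \<bullet> z then 1 else \<gamma>)" for a
  have [measurable]: "(\<lambda>a. a) \<in> borel_measurable lam" using lam by simp
  have r: "r \<in> borel_measurable lam" "\<forall>a\<in>space lam. \<gamma> \<le> r a \<and> r a \<le> 1"
    unfolding r_def using \<gamma> by auto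
  have "z \<bullet> (\<integral>a. r a *\<^sub>R a \<partial>lam) = (\<integral>a. z \<bullet> (r a *\<^sub>R a) \<partial>lam)"
    using gradient_integrand_integrable[OF lam \<gamma>(1) r] by (rule integral_inner_right[symmetric])
  also have "\<dots> = support_cost lam \<gamma> z"
    unfolding support_cost_def using \<gamma>
    by (intro Bochner_Integration.integral_cong)
      (auto simp: r_def max_def inner_commute mult_le_cancel_right1 mult_le_cancel_right2)
  finally show ?thesis
    using r that unfolding gradient_set_def by blast
qed

text \<open>Weight functions are mixed pointwise: their range is a convex interval and the integral
  is linear.\<close>

lemma gradient_set_convex: "convex (gradient_set lam \<gamma>)"
proof (rule convexI)
  fix x y and s t :: real
  assume st: "0 \<le> s" "0 \<le> t" "s + t = 1" and "x \<in> gradient_set lam \<gamma>" "y \<in> gradient_set lam \<gamma>"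
  then obtain q r where x: "x = (\<integral>a. q a *\<^sub>R a \<partial>lam)" and q: "q \<in> borel_measurable lam"
      "\<forall>a\<in>space lam. \<gamma> \<le> q a \<and> q a \<le> 1"
    and y: "y = (\<integral>a. r a *\<^sub>R a \<partial>lam)" and r: "r \<in> borel_measurable lam"
      "\<forall>a\<in>space lam. \<gamma> \<le> r a \<and> r a \<le> 1"
    unfolding gradient_set_def by auto
  have "s *\<^sub>R x + t *\<^sub>R y = (\<integral>a. s *\<^sub>R (q a *\<^sub>R a) + t *\<^sub>R (r a *\<^sub>R a) \<partial>lam)"
    unfolding x y using gradient_integrand_integrable[OF lam \<gamma>(1) q]
      gradient_integrand_integrable[OF lam \<gamma>(1) r] by (simp del: scaleR_scaleR)
  also have "\<dots> = (\<integral>a. (s * q a + t * r a) *\<^sub>R a \<partial>lam)"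
    by (simp add: scaleR_add_left)
  finally have eq: "s *\<^sub>R x + t *\<^sub>R y = (\<integral>a. (s * q a + t * r a) *\<^sub>R a \<partial>lam)" .
  have "\<gamma> \<le> s * q a + t * r a \<and> s * q a + t * r a \<le> 1" if "a \<in> space lam" for a
    using convexD[OF convex_real_interval(5)[of \<gamma> 1], of "q a" "r a" s t] q(2) r(2) st that by simp
  then show "s *\<^sub>R x + t *\<^sub>R y \<in> gradient_set lam \<gamma>"
    unfolding gradient_set_def eq using q(1) r(1)
    by (intro CollectI exI[of _ "\<lambda>a. s * q a + t * r a"]) auto
qed

text \<open>A point outside the closed convex set would be strictly separated from it by some
  direction \<open>a\<close>; the support value attained in direction \<open>- a\<close> contradicts
  the assumed bound there.\<close>

lemma closure_gradient_setI:
  assumes g: "\<And>z. z \<bullet> g \<le> support_cost lam \<gamma> z"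
  shows "g \<in> closure (gradient_set lam \<gamma>)"
proof (rule ccontr)
  assume "g \<notin> closure (gradient_set lam \<gamma>)"
  then obtain a b where ab: "a \<bullet> g < b" "\<And>x. x \<in> closure (gradient_set lam \<gamma>) \<Longrightarrow> b < a \<bullet> x"
    using separating_hyperplane_closed_point[of "closure (gradient_set lam \<gamma>)" g]
      convex_closure[OF gradient_set_convex] by auto
  obtain x where "x \<in> gradient_set lam \<gamma>" "(- a) \<bullet> x = support_cost lam \<gamma> (- a)"
    by (rule gradient_set_attains)
  then show False
    using g[of "- a"] ab(1) ab(2)[of x] closure_subset by fastforce
qed

text \<open>By the mean value theorem on the segment from \<open>y\<close> to \<open>x\<close>, the
  increment is the inner product of \<open>x - y\<close> with a single gradient.\<close>

lemma potential_of_gradient: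
  assumes "\<And>x. \<exists>g\<in>gradient_set lam \<gamma>. GDERIV u x :> g"
  shows "u x - u y \<le> support_cost lam \<gamma> (x - y)"
proof -
  obtain G where G: "\<And>x. G x \<in> gradient_set lam \<gamma>" "\<And>x. GDERIV u x :> G x"
    using assms by metis
  have "((\<lambda>t. u (y + t *\<^sub>R (x - y))) has_real_derivative (x - y) \<bullet> G (y + t *\<^sub>R (x - y))) (at t)" for t
  proof -
    have "((\<lambda>t. y + t *\<^sub>R (x - y)) has_derivative (\<lambda>s. s *\<^sub>R (x - y))) (at t)"
      by (auto intro!: derivative_eq_intros)
    from has_derivative_compose[OF this G(2)[unfolded gderiv_def]] show ?thesis
      unfolding has_field_derivative_def
      by (rule has_derivative_eq_rhs) (simp add: fun_eq_iff mult.commute)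
  qed
  from MVT2[OF zero_less_one this] obtain t where
    "u (y + 1 *\<^sub>R (x - y)) - u (y + 0 *\<^sub>R (x - y)) = (1 - 0) * ((x - y) \<bullet> G (y + t *\<^sub>R (x - y)))"
    by blast
  then show ?thesis
    using gradient_set_inner_le[OF G(1), of "x - y"] by simp
qed

text \<open>Every directional derivative is a limit of difference quotients that are bounded by the
  cost through positive homogeneity, so the gradient obeys all support inequalities.\<close>

lemma gradient_of_potential:
  assumes w: "\<And>x y. w x - w y \<le> support_cost lam \<gamma> (x - y)" and "w differentiable (at x)"
  obtains g where "GDERIV w x :> g" and "g \<in> closure (gradient_set lam \<gamma>)"
proof -
  obtain F where F: "(w has_derivative F) (at x)"
    using assms(2) unfolding differentiable_def by blast
  interpret F: bounded_linear F using F by (rule has_derivative_bounded_linear)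
  \<comment> \<open>The adjoint at 1 is the Riesz representative of the derivative.\<close>
  define g where "g = adjoint F 1"
  have F_eq: "F = (\<lambda>k. k \<bullet> g)"
    using adjoint_works[OF F.linear_axioms, of _ 1] unfolding g_def by auto
  have "z \<bullet> g \<le> support_cost lam \<gamma> z" for z
  proof -
    have 1: "((\<lambda>t::real. x + t *\<^sub>R z) has_derivative (\<lambda>s. s *\<^sub>R z)) (at 0)"
      by (auto intro!: derivative_eq_intros)
    have "((\<lambda>t. w (x + t *\<^sub>R z)) has_derivative (\<lambda>s. F (s *\<^sub>R z))) (at 0)"
      using has_derivative_compose[OF 1, of w F] F by simp
    then have "((\<lambda>t. w (x + t *\<^sub>R z)) has_real_derivative z \<bullet> g) (at 0)"
      unfolding F_eq has_field_derivative_def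
      by (rule has_derivative_eq_rhs) (simp add: fun_eq_iff mult.commute)
    \<comment> \<open>Only the limit from the right is taken, since the bound on the quotients rests
      on homogeneity for nonnegative factors.\<close>
    then have "((\<lambda>t. (w (x + t *\<^sub>R z) - w x) / t) \<longlongrightarrow> z \<bullet> g) (at_right 0)"
      unfolding has_field_derivative_iff by (auto intro: tendsto_mono[OF at_le])
    moreover have "\<forall>\<^sub>F t in at_right 0. (w (x + t *\<^sub>R z) - w x) / t \<le> support_cost lam \<gamma> z"
      using eventually_at_right_less
    proof (rule eventually_mono)
      fix t :: real assume t: "0 < t"
      have "w (x + t *\<^sub>R z) - w x \<le> t * support_cost lam \<gamma> z"
        using w[of "x + t *\<^sub>R z" x] support_cost_scale[OF lam \<gamma>, of t z] t by simp
      then show "(w (x + t *\<^sub>R z) - w x) / t \<le> support_cost lam \<gamma> z"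
        using t by (simp add: divide_le_eq mult.commute)
    qed
    ultimately show ?thesis
      by (rule tendsto_upperbound) simp
  qed
  then have "g \<in> closure (gradient_set lam \<gamma>)" by (rule closure_gradient_setI)
  moreover have "GDERIV w x :> g" unfolding gderiv_def using F F_eq by simp
  ultimately show ?thesis using that by blast
qed

text \<open>
  A mollified potential only has its gradients in the closure of the gradient set; mixing in a
  linear function with slope in the relative interior moves them into the set itself.
\<close>

lemma integral_potential_le:
  assumes P: "prob_space P" "sets P = sets borel" "integrable P (\<lambda>x. norm x)"
    and Q: "prob_space Q" "sets Q = sets borel" "integrable Q (\<lambda>x. norm x)"
    and test: "\<And>u. (\<And>x. \<exists>g\<in>gradient_set lam \<gamma>. GDERIV u x :> g) \<Longrightarrow> (\<integral>x. u x \<partial>P) \<le> (\<integral>x. u x \<partial>Q)"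
    and v: "\<And>x y. v x - v y \<le> support_cost lam \<gamma> (x - y)"
  shows "(\<integral>x. v x \<partial>P) \<le> (\<integral>x. v x \<partial>Q)"
proof -
  interpret P: prob_space P by fact
  interpret Q: prob_space Q by fact
  define C where "C = (\<integral>a. norm a \<partial>lam)"
  have cost_bound: "\<bar>support_cost lam \<gamma> z\<bar> \<le> C * norm z" for z
    unfolding C_def by (rule support_cost_bound[OF lam \<gamma>])
  note lip = potential_diff[OF cost_bound]
  have intP: "integrable P f" and intQ: "integrable Q f" if "\<And>x y. f x - f y \<le> support_cost lam \<gamma> (x - y)" for f
    using integrable_lipschitz[OF P lip[OF that]] integrable_lipschitz[OF Q lip[OF that]] by auto
  have "gradient_set lam \<gamma> \<noteq> {}" using gradient_set_attains by blast
  then obtain b where b: "b \<in> rel_interior (gradient_set lam \<gamma>)"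
    using rel_interior_eq_empty[OF gradient_set_convex] by blast
  have b_int: "integrable M (\<lambda>x. b \<bullet> x)"
    if "sets M = sets borel" "integrable M (\<lambda>x. norm x)" for M
  proof -
    have "(\<lambda>x. x) \<in> borel_measurable M" using that(1) by (simp cong: measurable_cong_sets)
    then have "integrable M (\<lambda>x. x)" using that(2) by (simp add: integrable_norm_iff)
    then show ?thesis by simp
  qed
  define K where "K = (\<integral>x. b \<bullet> x \<partial>Q) - (\<integral>x. b \<bullet> x \<partial>P)"
  define d where "d = (\<integral>x. v x \<partial>P) - (\<integral>x. v x \<partial>Q)"
  \<comment> \<open>The number \<open>e\<close> is both the mollification radius and the mixing
    weight. The term \<open>2 * C * e\<close> holds one approximation error per marginal, and
    \<open>e * K\<close> is the effect of the linear part.\<close>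
  have bound: "(1 - e) * (d - 2 * C * e) - e * K \<le> 0" if e: "0 < e" "e \<le> 1" for e
  proof -
    obtain w where w: "\<And>x. w differentiable (at x)" "\<And>x y. w x - w y \<le> support_cost lam \<gamma> (x - y)"
      "\<And>x. \<bar>w x - v x\<bar> \<le> C * e"
      using smooth_approximation[OF lip[OF v] v e(1)] by blast
    define u where "u x = (1 - e) * w x + e * (b \<bullet> x)" for x
    have "\<exists>g\<in>gradient_set lam \<gamma>. GDERIV u x :> g" for x
    proof -
      obtain g where g: "GDERIV w x :> g" "g \<in> closure (gradient_set lam \<gamma>)"
        using gradient_of_potential[OF w(2) w(1)] by blast
      \<comment> \<open>Moving from a closure point towards a relative interior point by a positive
        fraction lands in the relative interior.\<close>
      have "g - e *\<^sub>R (g - b) \<in> gradient_set lam \<gamma>"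
        using rel_interior_closure_convex_shrink[OF gradient_set_convex b g(2) e] rel_interior_subset by blast
      moreover have "GDERIV u x :> g - e *\<^sub>R (g - b)"
        using g(1) unfolding gderiv_def u_def
        by (auto intro!: derivative_eq_intros simp: inner_commute algebra_simps)
      ultimately show ?thesis by blast
    qed
    then have "(\<integral>x. u x \<partial>P) \<le> (\<integral>x. u x \<partial>Q)" by (rule test)
    then have "(1 - e) * ((\<integral>x. w x \<partial>P) - (\<integral>x. w x \<partial>Q)) \<le> e * K"
      unfolding u_def K_def using intP[OF w(2)] intQ[OF w(2)] b_int[OF P(2,3)] b_int[OF Q(2,3)]
      by (simp add: algebra_simps)
    moreover have "d - 2 * C * e \<le> (\<integral>x. w x \<partial>P) - (\<integral>x. w x \<partial>Q)"
    proof -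
      have "(\<integral>x. v x - C * e \<partial>P) \<le> (\<integral>x. w x \<partial>P)"
        using intP[OF w(2)] intP[OF v] w(3) by (intro integral_mono) (auto simp: abs_le_iff algebra_simps)
      moreover have "(\<integral>x. w x \<partial>Q) \<le> (\<integral>x. v x + C * e \<partial>Q)"
        using intQ[OF w(2)] intQ[OF v] w(3) by (intro integral_mono) (auto simp: abs_le_iff algebra_simps)
      ultimately show ?thesis
        unfolding d_def using intP[OF v] intQ[OF v] by (simp add: P.prob_space Q.prob_space)
    qed
    ultimately show ?thesis
      using mult_left_mono[of "d - 2 * C * e" "(\<integral>x. w x \<partial>P) - (\<integral>x. w x \<partial>Q)" "1 - e"] e by simp
  qed
  have "(\<lambda>n. (1 - inverse (real (Suc n))) * (d - 2 * C * inverse (real (Suc n))) - inverse (real (Suc n)) * K)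
      \<longlonglongrightarrow> (1 - 0) * (d - 2 * C * 0) - 0 * K"
    by (intro tendsto_intros LIMSEQ_inverse_real_of_nat)
  then have "(1 - 0) * (d - 2 * C * 0) - 0 * K \<le> 0"
    by (rule LIMSEQ_le_const2) (use bound[of "inverse (real (Suc n))" for n] in \<open>auto simp: inverse_le_1_iff\<close>)
  then show ?thesis unfolding d_def by simp
qed

end

section \<open>Compensated dominance as a transport inequality, and the final equivalence\<close>

lemma CSD_linear_scores_iff:
  fixes D :: "(real ^ 'n) set"
  assumes P: "prob_space P" "sets P = sets borel" "integrable P (\<lambda>x. norm x)" "AE x in P. x \<in> D"
    and Q: "prob_space Q" "sets Q = sets borel" "integrable Q (\<lambda>x. norm x)" "AE x in Q. x \<in> D"
    and lam: "integrable lam (\<lambda>a. a)" and \<gamma>: "0 \<le> \<gamma>" "\<gamma> \<le> 1"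
  shows "CSD D (\<lambda>a x. a \<bullet> x) lam \<gamma> P Q \<longleftrightarrow>
    (\<exists>\<kappa>\<in>couplings P Q. (\<integral>z. support_cost lam \<gamma> (fst z - snd z) \<partial>\<kappa>) \<le> 0)"
proof -
  \<comment> \<open>The two conditions are compared for each coupling separately. A difference of
    linear scores depends on \<open>x - y\<close> alone, so both inner integrals are values of
    \<open>?h\<close>.\<close>
  let ?h = "support_cost lam 0"
  have inner: "(\<integral>\<^sup>+a. ennreal (max (a \<bullet> x - a \<bullet> y) 0) \<partial>lam) = ennreal (?h (x - y))" for x y
    unfolding support_cost_def using lam
    by (subst nn_integral_eq_integral[symmetric]) (auto simp: inner_diff_right)
  have nonneg: "0 \<le> ?h z" for z
    unfolding support_cost_def by (intro Bochner_Integration.integral_nonneg) simp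
  have "(\<integral>\<^sup>+(x, y)\<in>D \<times> D. (\<integral>\<^sup>+a. ennreal (max (a \<bullet> x - a \<bullet> y) 0) \<partial>lam) \<partial>\<kappa>)
       \<le> ennreal \<gamma> * (\<integral>\<^sup>+(x, y)\<in>D \<times> D. (\<integral>\<^sup>+a. ennreal (max (a \<bullet> y - a \<bullet> x) 0) \<partial>lam) \<partial>\<kappa>)
     \<longleftrightarrow> (\<integral>z. support_cost lam \<gamma> (fst z - snd z) \<partial>\<kappa>) \<le> 0" if \<kappa>: "\<kappa> \<in> couplings P Q" for \<kappa>
  proof -
    have int1: "integrable \<kappa> (\<lambda>z. ?h (fst z - snd z))"
      using lam by (intro integrable_coupling_cost[OF P(1-3) Q(1-3) support_cost_subadditive support_cost_bound \<kappa>]) auto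
    \<comment> \<open>The reflected cost is subadditive with the same linear bound.\<close>
    have int2: "integrable \<kappa> (\<lambda>z. ?h (- (fst z - snd z)))"
      using lam support_cost_bound[of lam 0 "- z" for z] support_cost_subadditive[of lam 0 "- x" "- y" for x y]
      by (intro integrable_coupling_cost[OF P(1-3) Q(1-3), where h = "\<lambda>z. ?h (- z)" and C = "\<integral>a. norm a \<partial>lam"] \<kappa>) auto
    have distr: "distr \<kappa> P fst = P" "distr \<kappa> Q snd = Q"
      using \<kappa> unfolding couplings_def by auto
    \<comment> \<open>The marginals concentrate \<open>\<kappa>\<close> on
      \<open>D \<times> D\<close>, so the restriction changes neither integral.\<close>
    have "AE z in \<kappa>. fst z \<in> D" "AE z in \<kappa>. snd z \<in> D"
      using AE_distrD[OF couplings_measurable(1)[OF \<kappa>], of "\<lambda>x. x \<in> D", unfolded distr] P(4)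
        AE_distrD[OF couplings_measurable(2)[OF \<kappa>], of "\<lambda>x. x \<in> D", unfolded distr] Q(4)
      by blast+
    then have AE_D: "AE z in \<kappa>. z \<in> D \<times> D" by eventually_elim (simp add: mem_Times_iff)
    have "(\<integral>\<^sup>+(x, y)\<in>D \<times> D. (\<integral>\<^sup>+a. ennreal (max (a \<bullet> x - a \<bullet> y) 0) \<partial>lam) \<partial>\<kappa>)
        = (\<integral>\<^sup>+z. ennreal (?h (fst z - snd z)) \<partial>\<kappa>)"
      using AE_D by (intro nn_integral_cong_AE, eventually_elim) (auto simp: inner simp del: ennreal_max_0 ennreal_max_0')
    moreover have "(\<integral>\<^sup>+(x, y)\<in>D \<times> D. (\<integral>\<^sup>+a. ennreal (max (a \<bullet> y - a \<bullet> x) 0) \<partial>lam) \<partial>\<kappa>)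
        = (\<integral>\<^sup>+z. ennreal (?h (- (fst z - snd z))) \<partial>\<kappa>)"
      using AE_D by (intro nn_integral_cong_AE, eventually_elim) (auto simp: inner simp del: ennreal_max_0 ennreal_max_0')
    moreover have "(\<integral>z. support_cost lam \<gamma> (fst z - snd z) \<partial>\<kappa>)
        = (\<integral>z. ?h (fst z - snd z) \<partial>\<kappa>) - \<gamma> * (\<integral>z. ?h (- (fst z - snd z)) \<partial>\<kappa>)"
      unfolding support_cost_pos_neg_parts[OF lam \<gamma>] using int1 int2 by simp
    \<comment> \<open>Both integrals are finite and nonnegative, so the extended inequality is a
      real one and can be rearranged as a difference.\<close>
    ultimately show ?thesis
      using int1 int2 nonneg \<gamma>
      by (simp add: nn_integral_eq_integral Bochner_Integration.integral_nonneg del: minus_diff_eq flip: ennreal_mult)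
  qed
  then show ?thesis unfolding CSD_def by (rule bex_cong[OF refl])
qed

theorem proposition2p8:
  fixes D :: "(real ^ 'n) set"
    and P Q lam :: "(real ^ 'n) measure"
    and \<gamma> :: real
  assumes "D \<noteq> {}" and "D \<in> sets borel"
    and "prob_space P" and "sets P = sets borel" and "measure P D = 1"
    and "integrable P (\<lambda>x. norm x)"
    and "prob_space Q" and "sets Q = sets borel" and "measure Q D = 1"
    and "integrable Q (\<lambda>x. norm x)"
    and "finite_measure lam" and "sets lam = sets (restrict_space borel nonneg_orthant)"
    and "emeasure lam (space lam) \<noteq> 0"
    and "integrable lam (\<lambda>a. \<Sum>i\<in>UNIV. \<bar>a $ i\<bar>)"
    and "0 \<le> \<gamma>" and "\<gamma> \<le> 1"
  shows "CSD D (\<lambda>a x. a \<bullet> x) lam \<gamma> P Q \<longleftrightarrow>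
    (\<forall>u :: real ^ 'n \<Rightarrow> real.
       (\<forall>x. \<exists>g \<in> gradient_set lam \<gamma>. GDERIV u x :> g) \<longrightarrow>
       (LINT x:D|P. u x) \<le> (LINT x:D|Q. u x))"
proof -
  note P = assms(3,4,6) and Q = assms(7,8,10) and \<gamma> = assms(15,16)
  let ?h = "support_cost lam \<gamma>"
  let ?test = "\<lambda>u :: real ^ 'n \<Rightarrow> real. \<forall>x. \<exists>g \<in> gradient_set lam \<gamma>. GDERIV u x :> g"
  have lam: "integrable lam (\<lambda>a. a)"
  proof (rule Bochner_Integration.integrable_bound[OF assms(14)])
    show "(\<lambda>a. a) \<in> borel_measurable lam"
      using measurable_cong_sets[OF assms(12) refl] measurable_restrict_space1[OF measurable_ident_sets[OF refl]]
      by (auto simp: id_def)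
    show "AE a in lam. norm a \<le> norm (\<Sum>i\<in>UNIV. \<bar>a $ i\<bar>)"
      using norm_le_l1_cart by (intro AE_I2) (simp add: order_trans[OF _ abs_ge_self])
  qed
  have AE_D: "AE x in P. x \<in> D" "AE x in Q. x \<in> D"
    using assms(2,4,5,8,9) prob_space.AE_prob_1[OF assms(3), of D] prob_space.AE_prob_1[OF assms(7), of D]
    by auto
  \<comment> \<open>Test functions are continuous, hence measurable, and \<open>D\<close> has full
    measure, so the restricted integrals are ordinary ones.\<close>
  have LINT_D: "(LINT x:D|M. u x) = (\<integral>x. u x \<partial>M)"
    if "?test u" and M: "sets M = sets borel" and "AE x in M. x \<in> D" for u M
  proof -
    have "continuous_on UNIV u"
      using \<open>?test u\<close> has_derivative_continuous unfolding gderiv_def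
      by (intro continuous_at_imp_continuous_on) blast
    then have [measurable]: "u \<in> borel_measurable M"
      using M borel_measurable_continuous_onI by (simp cong: measurable_cong_sets)
    have [measurable]: "D \<in> sets M" using assms(2) M by simp
    show ?thesis
      unfolding set_lebesgue_integral_def
      by (rule integral_cong_AE) (use \<open>AE x in M. x \<in> D\<close> in auto)
  qed
  have bound: "\<bar>?h z\<bar> \<le> (\<integral>a. norm a \<partial>lam) * norm z" for z
    by (rule support_cost_bound[OF lam \<gamma>])
  have "(\<exists>\<kappa>\<in>couplings P Q. (\<integral>z. ?h (fst z - snd z) \<partial>\<kappa>) \<le> 0) \<longleftrightarrow>
      (\<forall>u. ?test u \<longrightarrow> (\<integral>x. u x \<partial>P) \<le> (\<integral>x. u x \<partial>Q))"
  proof (intro iffI allI impI)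
    fix u assume "?test u" "\<exists>\<kappa>\<in>couplings P Q. (\<integral>z. ?h (fst z - snd z) \<partial>\<kappa>) \<le> 0"
    then obtain \<kappa> where \<kappa>: "\<kappa> \<in> couplings P Q" "(\<integral>z. ?h (fst z - snd z) \<partial>\<kappa>) \<le> 0"
      by blast
    have u: "u x - u y \<le> ?h (x - y)" for x y
      using potential_of_gradient[OF lam \<gamma>] \<open>?test u\<close> by blast
    have uP: "integrable P u" and uQ: "integrable Q u"
      using integrable_lipschitz[OF P potential_diff[OF bound u]]
        integrable_lipschitz[OF Q potential_diff[OF bound u]] by auto
    note u_fst = couplings_fst[OF \<kappa>(1) borel_measurable_integrable[OF uP]]
      and u_snd = couplings_snd[OF \<kappa>(1) borel_measurable_integrable[OF uQ]]
    \<comment> \<open>The marginals turn the difference of integrals into one integral over the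
      coupling, where the potential bound holds pointwise.\<close>
    have "(\<integral>x. u x \<partial>P) - (\<integral>x. u x \<partial>Q) = (\<integral>z. u (fst z) - u (snd z) \<partial>\<kappa>)"
      using u_fst u_snd uP uQ by simp
    also have "\<dots> \<le> (\<integral>z. ?h (fst z - snd z) \<partial>\<kappa>)"
      using u_fst(1) u_snd(1) uP uQ u
        integrable_coupling_cost[OF P Q support_cost_subadditive[OF lam \<gamma>] bound \<kappa>(1)]
      by (intro integral_mono) auto
    finally show "(\<integral>x. u x \<partial>P) \<le> (\<integral>x. u x \<partial>Q)" using \<kappa>(2) by simp
  next
    assume test: "\<forall>u. ?test u \<longrightarrow> (\<integral>x. u x \<partial>P) \<le> (\<integral>x. u x \<partial>Q)"
    have "(\<integral>x. v x \<partial>P) \<le> (\<integral>x. v x \<partial>Q)" if "\<And>x y. v x - v y \<le> ?h (x - y)" for v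
      by (rule integral_potential_le[OF lam \<gamma> P Q _ that]) (simp add: test)
    from coupling_of_dual_inequality[OF P Q support_cost_subadditive[OF lam \<gamma>] bound this]
    obtain \<kappa> where "\<kappa> \<in> couplings P Q" "(\<integral>z. ?h (fst z - snd z) \<partial>\<kappa>) \<le> 0" .
    then show "\<exists>\<kappa>\<in>couplings P Q. (\<integral>z. ?h (fst z - snd z) \<partial>\<kappa>) \<le> 0" by blast
  qed
  also have "\<dots> \<longleftrightarrow> (\<forall>u. ?test u \<longrightarrow> (LINT x:D|P. u x) \<le> (LINT x:D|Q. u x))"
    using LINT_D P(2) Q(2) AE_D by auto
  finally show ?thesis
    using CSD_linear_scores_iff[OF P AE_D(1) Q AE_D(2) lam \<gamma>] by simp
qed

end
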